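(* Let $p$ be an odd prime and $q = p^n > 3$. Let $D_q$ be the unit-quadrance graph on $F_q^2$ and let $\chi(F_q^2)$ denote its chromatic number. Then \[ q^{1/2}\,(1/2 + o(1)) \leqslant \chi(F_q^2) \leqslant \frac{p^n + p^{n-1}}{2} = q\,(1/2 + o(1)), \] where $o(1)$ denotes a quantity tending to $0$ as $q \to \infty$.
   Context: $F_q$ denotes the finite field with $q$ elements. The quadrance between points $A_1 = (x_1,y_1)$ and $A_2 = (x_2,y_2)$ of $F_q^2$ is $Q(A_1,A_2) = (x_2-x_1)^2 + (y_2-y_1)^2 \in F_q$. The unit-quadrance graph $D_q$ has vertex set $F_q^2$, with two points $A_1, A_2$ adjacent if and only if $Q(A_1,A_2) = 1$. $\chi(F_q^2)$ is the chromatic number of $D_q$.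
   Formalization: The o(1) in the last equality is exactly 1/(2p), which does not tend to 0 as q → ∞ through powers of a fixed p (for p = 3 it is always 1/6); it is instead stated as a quantity depending on p that tends to 0 as p → ∞, uniformly in n. *)

theory Defs
  imports Complex_Main "HOL-Algebra.Ring" "HOL-Computational_Algebra.Primes"
begin

definition quadrance :: "('a, 'b) ring_scheme \<Rightarrow> 'a \<times> 'a \<Rightarrow> 'a \<times> 'a \<Rightarrow> 'a" where
  "quadrance F A B =
     ((fst B \<ominus>\<^bsub>F\<^esub> fst A) [^]\<^bsub>F\<^esub> (2::nat)) \<oplus>\<^bsub>F\<^esub> ((snd B \<ominus>\<^bsub>F\<^esub> snd A) [^]\<^bsub>F\<^esub> (2::nat))"

text \<open>A graph is given by its vertex set and its adjacency relation. The set of \<open>k\<close> for which a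
  proper \<open>k\<close>-colouring exists is nonempty for every finite loopless graph, so that the least
  element is meaningful there.\<close>

definition colourable :: "'v set \<Rightarrow> ('v \<Rightarrow> 'v \<Rightarrow> bool) \<Rightarrow> nat \<Rightarrow> bool" where
  "colourable V adj k \<longleftrightarrow>
     (\<exists>c. (\<forall>v\<in>V. c v < k) \<and> (\<forall>u\<in>V. \<forall>v\<in>V. adj u v \<longrightarrow> c u \<noteq> (c v :: nat)))"

definition chromatic_number :: "'v set \<Rightarrow> ('v \<Rightarrow> 'v \<Rightarrow> bool) \<Rightarrow> nat" where
  "chromatic_number V adj = (LEAST k. colourable V adj k)"

definition unit_quadrance_adj :: "('a, 'b) ring_scheme \<Rightarrow> 'a \<times> 'a \<Rightarrow> 'a \<times> 'a \<Rightarrow> bool" where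
  "unit_quadrance_adj F A B \<longleftrightarrow> quadrance F A B = \<one>\<^bsub>F\<^esub>"

definition plane_chromatic_number :: "('a, 'b) ring_scheme \<Rightarrow> nat" where
  "plane_chromatic_number F =
     chromatic_number (carrier F \<times> carrier F) (unit_quadrance_adj F)"

text \<open>Writing \<open>(p ^ n + p ^ (n - 1)) / 2 = q * (1/2 + \<delta>)\<close> with \<open>q = p ^ n\<close> forces \<open>\<delta> = 1 / (2 * p)\<close>. This does
  not tend to \<open>0\<close> when \<open>q\<close> runs through the powers of a fixed prime, so that error term can only be
  taken as \<open>p\<close> tends to infinity. It is then uniform in \<open>n\<close>, and for fixed \<open>n\<close> this is the same as \<open>q\<close>
  tending to infinity.\<close>

end

(*
Upper bound: choose a nonsquare N = a^2 + b^2. On a line in direction (a, b) all quadrances are N t^2,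
never 1, so the linear form -b x + a y already gives a proper colouring by q colours. If moreover
N - d^2 is a nonsquare for some d <> 0, two lines on which the form differs by d may share a colour;
pairing off consecutive lines in each cycle u, u + d, u + 2 d, ... of length p leaves (p + 1) / 2
colours per cycle.

Lower bound: this is Hoffman's bound. A Gauss sum computation shows that the nontrivial eigenvalues
of the graph are, up to sign, Kloosterman sums, so that everything rests on |K| <= 2 sqrt q. For
this we use only the extensions of degree 2^j. Counting solutions of x + y = s, x y = t over the
ground field and over its quadratic extension gives K' = 2 q - K^2, so normalised sums u = K / sqrt q
evolve by u' = 2 - u^2, and |u| > 2 at the start would make u tend to minus infinity very fast. On the
other hand the sum over all characters b of the ground field counts points of y^q - y = x + a / x,
equivalently of z^2 = (y^q - y)^2 - 4 a, and Stepanov's method in Bombieri's form bounds that count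
from below by Q - O(sqrt Q).
*)
theory Submission
  imports Defs "HOL-Algebra.Algebraic_Closure_Type" "HOL-Library.Cardinality"
begin

text \<open>Degrees 2^j are chosen because each quadratic step is an elementary count, and the
  recurrence u' = 2 - u^2 gives the upper bound 2 for every nontrivial character from the first
  extension on. What remains is a one-sided estimate of the sum over characters, so Stepanov's
  method only has to bound from above the number of y at which (y^q - y)^2 - 4 a is a nonsquare.
  Each extension in the tower has square order s^2, which lets the Frobenius map x -> x^s replace
  derivatives: the auxiliary polynomial has degree about s^2 / 2, and simple vanishing at the points
  is enough. All fields of the tower are fixed sets of Frobenius powers inside one algebraically
  closed type, whereas the field of the theorem is a record with a carrier; bridging the two is the
  purpose of the last section. In Hoffman's bound the degree is at least q - 1 and the nontrivial
  eigenvalues are at most 2 sqrt q in absolute value, so the ratio is sqrt q / 2 up to a term that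
  the summand 1 of the bound absorbs.\<close>

hide_const (open) Divisibility.prime Coset.order

section \<open>Finite subfields of an algebraically closed field\<close>

lemma inj_on_of_nat_CHAR: "inj_on (of_nat :: nat \<Rightarrow> 'a :: ring_1) {..<CHAR('a)}"
proof (rule linorder_inj_onI)
  fix i j assume ij: "i < j" "i \<in> {..<CHAR('a)}" "j \<in> {..<CHAR('a)}"
  show "of_nat i \<noteq> (of_nat j :: 'a)"
  proof
    assume "of_nat i = (of_nat j :: 'a)"
    then have "of_nat (j - i) = (0 :: 'a)" using ij by (simp add: of_nat_diff)
    then have "CHAR('a) dvd j - i" by (simp add: of_nat_eq_0_iff_char_dvd)
    then show False using ij by (auto dest: dvd_imp_le)
  qed
qed auto

lemma order_eq_1_if_simple_root:
  fixes p :: "'a :: idom poly"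
  assumes "poly p x = 0" "poly (pderiv p) x \<noteq> 0"
  shows "order x p = 1"
proof -
  have "p \<noteq> 0" using assms(2) by auto
  have "order x p \<noteq> 0" using assms(1) \<open>p \<noteq> 0\<close> by (simp add: order_root)
  moreover have "\<not> 2 \<le> order x p"
  proof
    assume "2 \<le> order x p"
    then have "[:-x, 1:] ^ 2 dvd p"
      by (simp add: order_divides)
    then obtain g where "p = [:-x, 1:] ^ 2 * g" by (elim dvdE)
    moreover have "poly (pderiv (h ^ 2 * g)) x = 0" if "poly h x = 0" for h
      using that by (simp add: pderiv_mult power2_eq_square)
    ultimately have "poly (pderiv p) x = 0" by simp
    then show False using assms(2) by simp
  qed
  ultimately show ?thesis by linarith
qed

lemma card_roots_separable:
  fixes p :: "'a :: alg_closed_field poly"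
  assumes "\<And>x. poly p x = 0 \<Longrightarrow> poly (pderiv p) x \<noteq> 0" "p \<noteq> 0"
  shows "card {x. poly p x = 0} = degree p"
  using assms
proof (induction "degree p" arbitrary: p)
  case 0
  then obtain c where "p = [:c:]" "c \<noteq> 0" by (metis degree_eq_zeroE pCons_0_0)
  then show ?case by simp
next
  case (Suc n)
  then obtain x where x: "poly p x = 0"
    using alg_closed_imp_poly_has_root[of p] by auto
  then obtain g where g: "p = [:-x, 1:] * g"
    using poly_eq_0_iff_dvd by (metis dvdE)
  have g0: "g \<noteq> 0" using g Suc.prems(2) by auto
  have deg: "degree p = Suc (degree g)"
    unfolding g using g0 by (subst degree_mult_eq) auto
  have der: "poly (pderiv p) y = poly g y + (y - x) * poly (pderiv g) y" for y
  proof -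
    have "pderiv [:-x, 1:] = 1" by (simp add: pderiv_pCons one_pCons)
    then show ?thesis
      unfolding g pderiv_mult by (simp add: algebra_simps)
  qed
  have gx: "poly g x \<noteq> 0" using Suc.prems(1)[OF x] der[of x] by simp
  have "card {y. poly g y = 0} = degree g"
  proof (rule Suc.hyps(1))
    show "n = degree g" using Suc.hyps(2) deg by simp
    show "poly (pderiv g) y \<noteq> 0" if "poly g y = 0" for y
      using Suc.prems(1)[of y] that der[of y] g by auto
  qed (rule g0)
  moreover have "{y. poly p y = 0} = insert x {y. poly g y = 0}"
    unfolding g by auto
  ultimately show ?case
    using gx g0 deg by (simp add: poly_roots_finite)
qed

text \<open>A finite field is modelled as the fixed set of \<open>x ^ Q\<close> in an algebraically
  closed field. Every extension is then another subset of the same type, Frobenius is a plain power,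
  and equations can be solved outside \<open>E\<close> before asking where their roots lie.\<close>

locale odd_subfield =
  fixes Q :: nat and k :: nat and E :: "'a :: alg_closed_field set"
  assumes prime_char: "prime CHAR('a)" and odd_char: "odd CHAR('a)"
    and k_pos: "0 < k" and Q_eq: "Q = CHAR('a) ^ k" and E_eq: "E = {x. x ^ Q = x}"
begin

lemma Q_gt_2: "2 < Q"
proof -
  have "2 < CHAR('a)"
    using prime_ge_2_nat[OF prime_char] odd_char by (cases "CHAR('a) = 2") auto
  also have "CHAR('a) \<le> Q"
    unfolding Q_eq using k_pos prime_gt_0_nat[OF prime_char] by (simp add: self_le_power)
  finally show ?thesis .
qed

lemma odd_Q: "odd Q"
  using odd_char by (simp add: Q_eq)

lemma frob_add: "(x + y :: 'a) ^ Q = x ^ Q + y ^ Q"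
  using freshmans_dream'[OF prime_char Q_eq] .

lemma frob_minus: "(- x :: 'a) ^ Q = - (x ^ Q)"
  using odd_Q by simp

lemma frob_diff: "(x - y :: 'a) ^ Q = x ^ Q - y ^ Q"
  using frob_add[of x "-y"] frob_minus[of y] by simp

lemma mem_E: "x \<in> E \<longleftrightarrow> x ^ Q = x"
  by (simp add: E_eq)

lemma zero_E [simp, intro]: "0 \<in> E" using Q_gt_2 by (simp add: mem_E)
lemma one_E [simp, intro]: "1 \<in> E" by (simp add: mem_E)
lemma add_E [intro]: "x \<in> E \<Longrightarrow> y \<in> E \<Longrightarrow> x + y \<in> E" by (simp add: mem_E frob_add)
lemma minus_E [intro]: "x \<in> E \<Longrightarrow> - x \<in> E" by (simp add: mem_E frob_minus)
lemma diff_E [intro]: "x \<in> E \<Longrightarrow> y \<in> E \<Longrightarrow> x - y \<in> E" by (simp add: mem_E frob_diff)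
lemma mult_E [intro]: "x \<in> E \<Longrightarrow> y \<in> E \<Longrightarrow> x * y \<in> E" by (simp add: mem_E power_mult_distrib)
lemma divide_E [intro]: "x \<in> E \<Longrightarrow> y \<in> E \<Longrightarrow> x / y \<in> E" by (simp add: mem_E power_divide)
lemma power_E [intro]: "x \<in> E \<Longrightarrow> x ^ n \<in> E" by (induction n) auto
lemma sum_E [intro]: "(\<And>i. i \<in> I \<Longrightarrow> f i \<in> E) \<Longrightarrow> sum f I \<in> E"
  by (induction I rule: infinite_finite_induct) auto
lemma of_nat_E [simp, intro]: "of_nat n \<in> E" by (induction n) auto
lemma numeral_E [simp, intro]: "numeral n \<in> E" using of_nat_E[of "numeral n"] by simp

lemma two_nz: "(2 :: 'a) \<noteq> 0"
proof
  assume "(2 :: 'a) = 0"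
  then have "CHAR('a) dvd 2" using of_nat_eq_0_iff_char_dvd[of 2, where 'a='a] by simp
  then have "CHAR('a) = 1 \<or> CHAR('a) = 2" using prime_nat_iff[of 2] two_is_prime_nat by auto
  then show False using odd_char by auto
qed

lemma of_nat_Q: "of_nat Q = (0 :: 'a)"
  using k_pos by (simp add: Q_eq)

lemma card_E: "card E = Q"
proof -
  define p where "p = monom 1 Q + [:0, -1 :: 'a:]"
  have deg: "degree p = Q"
    unfolding p_def using Q_gt_2 by (subst degree_add_eq_left) (simp_all add: degree_monom_eq)
  have "pderiv p = -1"
    using of_nat_Q by (simp add: p_def pderiv_add pderiv_monom pderiv_pCons one_pCons)
  moreover have "E = {x. poly p x = 0}"
    by (auto simp: p_def mem_E poly_monom)
  moreover have "p \<noteq> 0" using deg Q_gt_2 by auto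
  ultimately show ?thesis
    using card_roots_separable[of p] deg by simp
qed

lemma finite_E [simp]: "finite E"
  using card_E Q_gt_2 by (metis card.infinite not_less_zero)

lemma sum_shift:
  assumes "c \<in> E"
  shows "(\<Sum>x\<in>E. f (c + x)) = (\<Sum>x\<in>E. f x)"
  by (rule sum.reindex_bij_witness[of _ "\<lambda>x. x - c" "\<lambda>x. c + x"]) (use assms in auto)

lemma sum_scale:
  assumes "c \<in> E" "c \<noteq> 0"
  shows "(\<Sum>x\<in>E. f (c * x)) = (\<Sum>x\<in>E. f x)"
  by (rule sum.reindex_bij_witness[of _ "\<lambda>x. x / c" "\<lambda>x. c * x"]) (use assms in auto)

end

lemma odd_subfield_power:
  assumes "odd_subfield Q k (E :: 'a :: alg_closed_field set)" "0 < n"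
  shows "odd_subfield (Q ^ n) (k * n) {x :: 'a. x ^ (Q ^ n) = x}"
  using assms unfolding odd_subfield_def by (auto simp: power_mult)

section \<open>Stepanov's method\<close>

context odd_subfield
begin

lemma coeff_mult_E:
  assumes "\<And>n. coeff f n \<in> E" "\<And>n. coeff g n \<in> E"
  shows "coeff (f * g) n \<in> E"
  using assms by (auto simp: coeff_mult)

lemma coeff_power_E:
  assumes "\<And>n. coeff f n \<in> E"
  shows "coeff (f ^ m) n \<in> E"
proof (induction m arbitrary: n)
  case 0 show ?case by (cases n) auto
next
  case (Suc m)
  then show ?case using coeff_mult_E[OF assms, of "f ^ m"] by simp
qed

lemma coeff_monom_E: "c \<in> E \<Longrightarrow> coeff (monom c m) n \<in> E"
  by auto

text \<open>Multiplying by \<open>a - b * f ^ (r + 1)\<close> replaces \<open>f ^ (r + 1)\<close> by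
  its square \<open>f * f ^ s\<close>, and modulo X^s the factor \<open>f ^ s\<close> is the
  constant f(0)^s. So a^2 and f(0)^s b^2 f agree modulo X^s; both have degree below s, hence they
  are equal. At the simple root \<open>\<rho>\<close> one side has even order and the other odd
  order unless b = 0.\<close>

lemma stepanov_nonvanishing:
  fixes f a b :: "'a poly"
  assumes deg_f: "degree f \<le> 2 * d" and f0: "poly f 0 \<noteq> 0" and simple: "order \<rho> f = 1"
    and s: "s = CHAR('a) ^ m" "s = 2 * r + 1"
    and deg: "degree a \<le> r - d" "degree b \<le> r - d" "d \<le> r"
    and dvd: "monom 1 s dvd a + b * f ^ (r + 1)"
  shows "a = 0 \<and> b = 0"
proof -
  define c where "c = poly f 0"
  have "[:0, 1:] dvd f - [:c:]"
    using poly_eq_0_iff_dvd[of "f - [:c:]" 0] by (simp add: c_def)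
  then have "[:0, 1:] ^ s dvd (f - [:c:]) ^ s" by (rule dvd_power_same)
  moreover have "(f + - [:c:]) ^ s = f ^ s + (- [:c:]) ^ s"
    by (rule freshmans_dream'[where n = m]) (use s prime_char in simp_all)
  moreover have "(- [:c:]) ^ s = - ([:c:] ^ s)" by (rule power_minus_odd) (simp add: s(2))
  moreover have "[:c:] ^ s = [:c ^ s:]" by (simp add: poly_const_pow)
  ultimately have "[:0, 1:] ^ s dvd f ^ s - [:c ^ s:]"
    by (metis diff_conv_add_uminus)
  then have 1: "monom 1 s dvd f ^ s - [:c ^ s:]"
    by (simp add: monom_altdef)
  have "monom 1 s dvd (a + b * f ^ (r + 1)) * (a - b * f ^ (r + 1))"
    using dvd by (rule dvd_mult2)
  also have "(a + b * f ^ (r + 1)) * (a - b * f ^ (r + 1)) = a ^ 2 - b ^ 2 * (f ^ (r + 1)) ^ 2"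
    by (simp add: algebra_simps power2_eq_square)
  also have "(f ^ (r + 1)) ^ 2 = f * f ^ s"
    unfolding s(2) by (simp add: mult_2 power_add power2_eq_square)
  finally have "monom 1 s dvd a ^ 2 - b ^ 2 * (f * f ^ s) + (b ^ 2 * f) * (f ^ s - [:c ^ s:])"
    using 1 by (intro dvd_add dvd_mult) 
  also have "\<dots> = a ^ 2 - b ^ 2 * f * [:c ^ s:]"
    by (simp add: algebra_simps)
  finally have 2: "monom 1 s dvd a ^ 2 - b ^ 2 * f * [:c ^ s:]" .
  have "degree (a ^ 2) < s"
    using degree_power_le[of a 2] deg s(2) by simp
  moreover have "degree (b ^ 2 * f * [:c ^ s:]) \<le> degree (b ^ 2) + degree f + 0"
    by (intro order_trans[OF degree_mult_le] add_mono order_refl) auto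
  then have "degree (b ^ 2 * f * [:c ^ s:]) < s"
    using degree_power_le[of b 2] deg s(2) deg_f by simp
  ultimately have "degree (a ^ 2 - b ^ 2 * f * [:c ^ s:]) < s"
    by (rule degree_diff_less)
  with 2 have eq: "a ^ 2 = b ^ 2 * f * [:c ^ s:]"
    using dvd_imp_degree_le[OF 2] by (auto simp: degree_monom_eq)
  have "b = 0"
  proof (rule ccontr)
    assume b: "b \<noteq> 0"
    have nz: "b ^ 2 * f * [:c ^ s:] \<noteq> 0" using b f0 by (auto simp: c_def)
    then have "a \<noteq> 0" using eq by auto
    have o0: "order \<rho> [:c ^ s:] = 0" using f0 by (auto simp: c_def intro: order_0I)
    have "order \<rho> (a ^ 2) = 2 * order \<rho> a"
      using \<open>a \<noteq> 0\<close> by (simp add: power2_eq_square order_mult)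
    moreover have "order \<rho> (b ^ 2 * f * [:c ^ s:]) = order \<rho> (b ^ 2) + order \<rho> f + order \<rho> [:c ^ s:]"
      by (subst order_mult[OF nz], subst order_mult) (use nz in auto)
    moreover have "order \<rho> (b ^ 2) = 2 * order \<rho> b"
      using b by (simp add: power2_eq_square order_mult)
    ultimately have "2 * order \<rho> a = 2 * order \<rho> b + 1" using eq simple o0 by simp
    then show False by presburger
  qed
  with eq show ?thesis by simp
qed

text \<open>The field has s^2 elements and \<open>2 * r\<^sup>2 + 2 * r\<close> is half of s^2 - 1,
  so \<open>\<sigma>\<close> = -1 selects the y with f(y) a nonsquare. At a selected point, y^(s^2)
  = y turns the s-th power of the value of \<open>H c\<close> into the value of \<open>G c\<close>.
  Since \<open>G c\<close> has fewer coefficients than there are parameters \<open>c\<close>, a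
  nonzero \<open>c\<close> with \<open>G c = 0\<close> exists; then \<open>H c\<close> vanishes at
  all selected points and its degree bounds their number.\<close>

lemma stepanov:
  fixes f :: "'a poly" and \<sigma> :: 'a
  assumes f_E: "\<And>n. coeff f n \<in> E" and deg_f: "degree f \<le> 2 * d" and f0: "poly f 0 \<noteq> 0"
    and simple: "order \<rho> f = 1" and \<sigma>: "\<sigma> \<in> E"
    and s: "s = Q ^ i" "s = 2 * r + 1" and r: "2 * d \<le> r" "0 < r"
  shows "card {y. y ^ s\<^sup>2 = y \<and> poly f y ^ (2 * r\<^sup>2 + 2 * r) = \<sigma>} \<le> 2 * r\<^sup>2 + 2 * r + 3 * d * s"
proof -
  \<comment> \<open>\<open>D\<close> is the largest range for which the inner polynomials keep
    degree at most \<open>r - d\<close>, as \<open>stepanov_nonvanishing\<close> demands.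
    \<open>M\<close> exceeds the degree of every \<open>G c\<close>, and \<open>B\<close> makes the
    number \<open>2 * B * D\<close> of parameters exceed \<open>M\<close>, given
    \<open>2 * d \<le> r\<close>. The Boolean index in \<open>J\<close> marks the terms with the
    factor \<open>f ^ e\<close>.\<close>
  define B D M where "B = r + 1 + 2 * d" and "D = r + 1 - d" and "M = 2 * r\<^sup>2 + 2 * r + 1 + 3 * d"
  define I where "I = {..<B} \<times> {..<D}"
  define J where "J = {..<B} \<times> {..<D} \<times> (UNIV :: bool set)"
  define e where "e = r + 1"
  define G where "G c = (\<Sum>(i, j)\<in>I. smult (c (i, j, False)) (monom 1 (j * s + i))
      + smult (\<sigma> * c (i, j, True)) (monom 1 (j * s + i) * f ^ e))" for c :: "nat \<times> nat \<times> bool \<Rightarrow> 'a"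
  define H where "H c = (\<Sum>(i, j)\<in>I. smult (c (i, j, False)) (monom 1 (j + i * s))
      + smult (c (i, j, True)) (monom 1 (j + i * s) * f ^ e))" for c :: "nat \<times> nat \<times> bool \<Rightarrow> 'a"
  have s_char: "s = CHAR('a) ^ (k * i)" using s(1) by (simp add: Q_eq power_mult)
  have D: "D \<le> r + 1" "D + d = r + 1" using r by (auto simp: D_def)
  have finI: "finite I" and finJ: "finite J" by (auto simp: I_def J_def)
  have deg_fe: "degree (f ^ e) \<le> 2 * d * e"
    by (rule order_trans[OF degree_power_le]) (use deg_f in simp)

  have deg_G: "degree (G c) < M" for c
    unfolding G_def
  proof (rule degree_sum_less, clarify)
    fix i j assume ij: "(i, j) \<in> I"
    have "j * s + i + 2 * d * e < M"
    proof -
      have "j \<le> r - d" "i \<le> r + 2 * d" using ij D by (auto simp: I_def B_def)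
      then have "j * s + i + 2 * d * e \<le> (r - d) * s + (r + 2 * d) + 2 * d * e"
        by (intro add_mono mult_mono) auto
      also have "\<dots> < M"
      proof -
        obtain t where t: "r = d + t" using r(1) by (metis le_add_diff_inverse le_add2 mult_2 order_trans)
        show ?thesis unfolding M_def s(2) e_def t by (simp add: algebra_simps power2_eq_square)
      qed
      finally show ?thesis .
    qed
    moreover have "degree (smult (\<sigma> * c (i, j, True)) (monom 1 (j * s + i) * f ^ e)) \<le> j * s + i + 2 * d * e"
      by (rule order_trans[OF degree_smult_le], rule order_trans[OF degree_mult_le])
         (use deg_fe in \<open>simp add: degree_monom_eq\<close>)
    moreover have "degree (smult (c (i, j, False)) (monom 1 (j * s + i))) \<le> j * s + i"
      by (rule order_trans[OF degree_smult_le]) (simp add: degree_monom_eq)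
    ultimately show "degree (smult (c (i, j, False)) (monom 1 (j * s + i)) +
           smult (\<sigma> * c (i, j, True)) (monom 1 (j * s + i) * f ^ e)) < M"
      by (intro degree_add_less) auto
  qed (simp add: M_def)

  have coeff_G: "coeff (G c) n \<in> E" if "\<And>x. x \<in> J \<Longrightarrow> c x \<in> E" for c n
  proof -
    have "coeff (smult (c (i, j, False)) (monom 1 (j * s + i))
        + smult (\<sigma> * c (i, j, True)) (monom 1 (j * s + i) * f ^ e)) n \<in> E" if "(i, j) \<in> I" for i j
    proof -
      have "(i, j, False) \<in> J" "(i, j, True) \<in> J" using that by (auto simp: I_def J_def)
      then have "c (i, j, False) \<in> E" "c (i, j, True) \<in> E"
        using \<open>\<And>x. x \<in> J \<Longrightarrow> c x \<in> E\<close> by auto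
      then show ?thesis
        unfolding coeff_add coeff_smult
        by (intro add_E mult_E coeff_mult_E coeff_power_E f_E coeff_monom_E \<sigma> one_E)
    qed
    then show ?thesis
      unfolding G_def coeff_sum by (intro sum_E) auto
  qed

  \<comment> \<open>Pigeonhole in place of linear algebra: there are Q^(2 B D) parameter vectors
    over \<open>E\<close> but at most Q^M coefficient lists, and \<open>G\<close> is linear in
    \<open>c\<close>, so a collision yields a nonzero element of the kernel. The parameters are
    confined to \<open>E\<close> because \<open>H_root\<close> relies on c^s = c.\<close>
  have "\<exists>c. (\<forall>x\<in>J. c x \<in> E) \<and> (\<exists>x\<in>J. c x \<noteq> 0) \<and> G c = 0"
  proof -
    define \<Phi> where "\<Phi> c = restrict (coeff (G c)) {..<M}" for c
    define U where "U = PiE J (\<lambda>_. E)"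
    have "\<Phi> ` U \<subseteq> PiE {..<M} (\<lambda>_. E)"
      using coeff_G by (auto simp: \<Phi>_def U_def PiE_def Pi_def)
    moreover have "card (PiE {..<M} (\<lambda>_. E)) = Q ^ M"
      by (simp add: card_PiE card_E)
    moreover have "finite (PiE {..<M} (\<lambda>_. E))" by (intro finite_PiE) auto
    moreover have "card U = Q ^ (2 * B * D)"
      using finJ by (simp add: U_def card_PiE card_E J_def card_cartesian_product mult_ac)
    moreover have "M < 2 * B * D"
    proof -
      obtain t where t: "r = 2 * d + t" using r(1) by (metis le_add_diff_inverse)
      have "D = d + t + 1" using D(2) t by simp
      then show ?thesis using r(2) unfolding M_def B_def t
        by (simp add: algebra_simps power2_eq_square)
    qed
    then have "Q ^ M < Q ^ (2 * B * D)" using Q_gt_2 by (intro power_strict_increasing) auto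
    ultimately have "\<not> inj_on \<Phi> U"
      by (metis card_inj_on_le not_le)
    then obtain c1 c2 where c: "c1 \<in> U" "c2 \<in> U" "c1 \<noteq> c2" "\<Phi> c1 = \<Phi> c2"
      by (auto simp: inj_on_def)
    have "G c1 = G c2"
    proof (rule poly_eqI)
      fix n show "coeff (G c1) n = coeff (G c2) n"
      proof (cases "n < M")
        case True
        then show ?thesis using fun_cong[OF c(4), of n] by (simp add: \<Phi>_def)
      next
        case False
        then show ?thesis using deg_G[of c1] deg_G[of c2] by (simp add: coeff_eq_0)
      qed
    qed
    moreover have "G (\<lambda>x. c1 x - c2 x) = G c1 - G c2"
      unfolding G_def by (simp add: case_prod_unfold sum_subtractf[symmetric] smult_diff_left algebra_simps)
    ultimately have "G (\<lambda>x. c1 x - c2 x) = 0" by simp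
    moreover have "\<exists>x\<in>J. c1 x \<noteq> c2 x"
      using c unfolding U_def by (metis PiE_ext)
    moreover have "\<forall>x\<in>J. c1 x - c2 x \<in> E" using c unfolding U_def by auto
    ultimately show ?thesis by (intro exI[of _ "\<lambda>x. c1 x - c2 x"]) auto
  qed
  then obtain c where c_E: "\<And>x. x \<in> J \<Longrightarrow> c x \<in> E" and c_nz: "\<exists>x\<in>J. c x \<noteq> 0" and Gc: "G c = 0"
    by blast

  have H_root: "poly (H c) y = 0" if y: "y ^ s\<^sup>2 = y" "poly f y ^ (2 * r\<^sup>2 + 2 * r) = \<sigma>" for y
  proof -
    have fy: "(poly f y ^ e) ^ s = \<sigma> * poly f y ^ e"
    proof -
      \<comment> \<open>This identity dictates e = r + 1: the s-th power of f(y)^e is the prescribed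
        power of f(y) times f(y)^e.\<close>
      have "e * s = (2 * r\<^sup>2 + 2 * r) + e"
        by (simp add: e_def s(2) algebra_simps power2_eq_square)
      then show ?thesis using y(2) by (simp add: power_mult[symmetric] power_add)
    qed
    have cs: "c x ^ s = c x" if "x \<in> J" for x
      using c_E[OF that] unfolding s(1) mem_E by (induction i) (auto simp: power_mult)
    have ys: "(y ^ (j + i * s)) ^ s = y ^ (j * s + i)" for i j
    proof -
      have "(y ^ (j + i * s)) ^ s = y ^ (j * s) * (y ^ s\<^sup>2) ^ i"
        by (simp add: power_mult[symmetric] power_add[symmetric] algebra_simps power2_eq_square)
      then show ?thesis by (simp add: y power_add)
    qed
    have "poly (H c) y ^ s = (\<Sum>(i, j)\<in>I. c (i, j, False) * y ^ (j + i * s)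
        + c (i, j, True) * (y ^ (j + i * s) * poly f y ^ e)) ^ s"
      by (simp add: H_def poly_sum case_prod_unfold poly_monom)
    also have "\<dots> = (\<Sum>(i, j)\<in>I. (c (i, j, False) * y ^ (j + i * s)
        + c (i, j, True) * (y ^ (j + i * s) * poly f y ^ e)) ^ s)"
      by (simp add: freshmans_dream_sum'[OF prime_char s_char] case_prod_unfold)
    also have "\<dots> = (\<Sum>(i, j)\<in>I. c (i, j, False) * y ^ (j * s + i)
        + \<sigma> * c (i, j, True) * (y ^ (j * s + i) * poly f y ^ e))"
    proof (rule sum.cong, goal_cases)
      case (2 x)
      then obtain i j where x: "x = (i, j)" "(i, j) \<in> I" by (cases x) auto
      then have "(i, j, False) \<in> J" "(i, j, True) \<in> J" by (auto simp: I_def J_def)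
      then show ?case
        by (simp add: x freshmans_dream'[OF prime_char s_char] power_mult_distrib cs ys fy mult_ac)
    qed simp
    also have "\<dots> = poly (G c) y"
      by (simp add: G_def poly_sum case_prod_unfold poly_monom)
    finally show ?thesis using Gc by simp
  qed

  have H_nz: "H c \<noteq> 0"
  proof
    assume H0: "H c = 0"
    \<comment> \<open>\<open>H c\<close> is read as an expansion in X^s with blocks
      \<open>A False i + A True i * f ^ e\<close>. Once X^(i0 s) is cancelled, all later blocks are
      divisible by X^s, hence so is the lowest one, and \<open>stepanov_nonvanishing\<close> makes
      it vanish.\<close>
    define i0 where "i0 = (LEAST i. \<exists>j z. (i, j, z) \<in> J \<and> c (i, j, z) \<noteq> 0)"
    have "\<exists>i j z. (i, j, z) \<in> J \<and> c (i, j, z) \<noteq> 0" using c_nz by (metis prod_cases3)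
    then have ex0: "\<exists>j z. (i0, j, z) \<in> J \<and> c (i0, j, z) \<noteq> 0"
      unfolding i0_def by (rule LeastI_ex)
    have less0: "c (i, j, z) = 0" if "i < i0" "(i, j, z) \<in> J" for i j z
      using not_less_Least[of i "\<lambda>i. \<exists>j z. (i, j, z) \<in> J \<and> c (i, j, z) \<noteq> 0"] that
      unfolding i0_def by blast
    define A where "A z i = (\<Sum>j<D. monom (c (i, j, z)) j)" for z i
    have H_alt: "H c = (\<Sum>i<B. monom 1 (i * s) * (A False i + A True i * f ^ e))"
    proof -
      have "smult (c (i, j, False)) (monom 1 (j + i * s)) + smult (c (i, j, True)) (monom 1 (j + i * s) * f ^ e)
          = monom 1 (i * s) * (monom (c (i, j, False)) j + monom (c (i, j, True)) j * f ^ e)" for i j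
      proof -
        have "smult a (monom 1 (j + i * s)) = monom 1 (i * s) * monom a j" for a :: 'a
          by (simp add: smult_monom mult_monom add.commute)
        moreover have "smult a (monom 1 (j + i * s) * f ^ e) = smult a (monom 1 (j + i * s)) * f ^ e" for a :: 'a
          by simp
        ultimately show ?thesis by (simp only: distrib_left mult.assoc)
      qed
      then show ?thesis
        unfolding H_def I_def sum.cartesian_product[symmetric] A_def
        by (simp only: sum_distrib_left sum_distrib_right sum.distrib[symmetric])
    qed
    have i0B: "i0 < B" using ex0 by (auto simp: J_def)
    define R where "R = (\<Sum>i\<in>{i0<..<B}. monom 1 ((i - i0 - 1) * s) * (A False i + A True i * f ^ e))"
    have H1: "H c = (\<Sum>i\<in>{i0..<B}. monom 1 (i * s) * (A False i + A True i * f ^ e))"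
      unfolding H_alt
    proof (rule sum.mono_neutral_right, goal_cases)
      case 3
      have "A z i = 0" if "i < i0" "i < B" for z i
        unfolding A_def using less0[OF that(1)] that by (auto simp: J_def intro!: sum.neutral)
      then show ?case by auto
    qed auto
    have set: "{i0..<B} = insert i0 {i0<..<B}" using i0B by auto
    have H2: "(\<Sum>i\<in>insert i0 {i0<..<B}. monom 1 (i * s) * (A False i + A True i * f ^ e))
      = monom 1 (i0 * s) * (A False i0 + A True i0 * f ^ e) 
        + (\<Sum>i\<in>{i0<..<B}. monom 1 (i * s) * (A False i + A True i * f ^ e))"
      by simp
    have H3: "(\<Sum>i\<in>{i0<..<B}. monom 1 (i * s) * (A False i + A True i * f ^ e))
       = monom 1 (i0 * s) * (monom 1 s * R)"
      unfolding R_def sum_distrib_left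
    proof (rule sum.cong, goal_cases)
      case (2 i)
      then have "i = i0 + (1 + (i - i0 - 1))" by auto
      then have "i * s = (i0 + (1 + (i - i0 - 1))) * s" by simp
      then have "i * s = i0 * s + (s + (i - i0 - 1) * s)" by (simp only: distrib_right mult_1)
      then have "monom (1 :: 'a) (i * s) = monom 1 (i0 * s) * (monom 1 s * monom 1 ((i - i0 - 1) * s))"
        by (simp only: mult_monom mult_1)
      then show ?case by (simp only: mult.assoc)
    qed simp
    have "monom 1 (i0 * s) * (A False i0 + A True i0 * f ^ e + monom 1 s * R) = 0"
      using H0 unfolding H1 set H2 H3 by (simp only: distrib_left)
    then have "A False i0 + A True i0 * f ^ e = monom 1 s * (- R)"
      by (simp add: monom_eq_0_iff eq_neg_iff_add_eq_0)
    then have dvd: "monom 1 s dvd A False i0 + A True i0 * f ^ (r + 1)"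
      unfolding e_def by simp
    have deg_A: "degree (A z i0) \<le> r - d" for z
      unfolding A_def
      by (rule degree_sum_le) (use D in \<open>auto intro!: order_trans[OF degree_monom_le]\<close>)
    have "A False i0 = 0 \<and> A True i0 = 0"
      using stepanov_nonvanishing[OF deg_f f0 simple s_char s(2) deg_A deg_A _ dvd] r by simp
    then have A0: "A z i0 = 0" for z by (cases z) auto
    have "c (i0, j, z) = 0" if "(i0, j, z) \<in> J" for j z
    proof -
      have "coeff (A z i0) j = c (i0, j, z)"
        using that by (simp add: A_def coeff_sum J_def)
      then show ?thesis by (simp add: A0)
    qed
    then show False using ex0 by blast
  qed

  have "card {y. y ^ s\<^sup>2 = y \<and> poly f y ^ (2 * r\<^sup>2 + 2 * r) = \<sigma>} \<le> card {y. poly (H c) y = 0}"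
    using H_root H_nz by (intro card_mono) (auto simp: poly_roots_finite)
  also have "\<dots> \<le> degree (H c)" by (rule card_poly_roots_bound) (rule H_nz)
  also have "\<dots> \<le> 2 * r\<^sup>2 + 2 * r + 3 * d * s"
    unfolding H_def
  proof (rule degree_sum_le, use finI in simp, clarify)
    fix i j assume ij: "(i, j) \<in> I"
    have "j + i * s + 2 * d * e \<le> 2 * r\<^sup>2 + 2 * r + 3 * d * s"
    proof -
      have "j + d \<le> r" "i \<le> r + 2 * d" using ij D by (auto simp: I_def B_def)
      then have "j + d + i * s + 2 * d * e \<le> r + (r + 2 * d) * s + 2 * d * e"
        by (intro add_mono mult_mono) auto
      also have "\<dots> \<le> 2 * r\<^sup>2 + 2 * r + 3 * d * s + d"
        unfolding s(2) e_def by (simp add: algebra_simps power2_eq_square)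
      finally show ?thesis by simp
    qed
    moreover have "degree (smult (c (i, j, True)) (monom 1 (j + i * s) * f ^ e)) \<le> j + i * s + 2 * d * e"
      by (rule order_trans[OF degree_smult_le], rule order_trans[OF degree_mult_le])
         (use deg_fe in \<open>simp add: degree_monom_eq\<close>)
    moreover have "degree (smult (c (i, j, False)) (monom 1 (j + i * s))) \<le> j + i * s"
      by (rule order_trans[OF degree_smult_le]) (simp add: degree_monom_eq)
    ultimately show "degree (smult (c (i, j, False)) (monom 1 (j + i * s)) +
           smult (c (i, j, True)) (monom 1 (j + i * s) * f ^ e)) \<le> 2 * r\<^sup>2 + 2 * r + 3 * d * s"
      by (intro degree_add_le) auto
  qed
  finally show ?thesis .
qed

end

section \<open>Kloosterman sums over quadratic extensions\<close>

definition add_character :: "'a :: field set \<Rightarrow> ('a \<Rightarrow> complex) \<Rightarrow> bool" where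
  "add_character E \<psi> \<longleftrightarrow> (\<forall>x\<in>E. \<forall>y\<in>E. \<psi> (x + y) = \<psi> x * \<psi> y) \<and> (\<forall>x\<in>E. norm (\<psi> x) = 1) \<and> (\<exists>x\<in>E. \<psi> x \<noteq> 1)"

definition kloosterman :: "'a :: field set \<Rightarrow> ('a \<Rightarrow> complex) \<Rightarrow> 'a \<Rightarrow> complex" where
  "kloosterman E \<psi> a = (\<Sum>x\<in>E - {0}. \<psi> (x + a / x))"

lemma add_character_add: "add_character E \<psi> \<Longrightarrow> x \<in> E \<Longrightarrow> y \<in> E \<Longrightarrow> \<psi> (x + y) = \<psi> x * \<psi> y"
  by (simp add: add_character_def)

lemma add_character_zero:
  assumes "add_character E \<psi>" "0 \<in> E"
  shows "\<psi> 0 = 1"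
proof -
  have "\<psi> 0 = \<psi> 0 * \<psi> 0" using add_character_add[OF assms(1,2,2)] by simp
  moreover have "\<psi> 0 \<noteq> 0" using assms by (auto simp: add_character_def)
  ultimately show ?thesis by simp
qed

lemma add_character_minus:
  assumes "add_character E \<psi>" "0 \<in> E" "x \<in> E" "- x \<in> E"
  shows "\<psi> (- x) = cnj (\<psi> x)"
proof -
  have "\<psi> x * \<psi> (- x) = 1"
    using add_character_add[OF assms(1,3,4)] add_character_zero[OF assms(1,2)] by simp
  moreover have "\<psi> x * cnj (\<psi> x) = 1"
    using assms by (simp add: add_character_def complex_norm_square[symmetric])
  moreover have "\<psi> x \<noteq> 0" using assms by (auto simp: add_character_def)
  ultimately show ?thesis by (metis mult_left_cancel)
qed

context odd_subfield
begin

lemma add_character_scale: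
  assumes "add_character E \<psi>" "b \<in> E" "b \<noteq> 0"
  shows "add_character E (\<lambda>x. \<psi> (b * x))"
proof -
  obtain y where "y \<in> E" "\<psi> y \<noteq> 1" using assms by (auto simp: add_character_def)
  then have "\<exists>x\<in>E. \<psi> (b * x) \<noteq> 1" using assms by (intro bexI[of _ "y / b"]) auto
  then show ?thesis
    using assms(1,2) unfolding add_character_def by (auto simp: distrib_left)
qed

lemma sum_add_character:
  assumes "add_character E \<psi>" "c \<in> E"
  shows "(\<Sum>x\<in>E. \<psi> (c * x)) = (if c = 0 then of_nat Q else 0)"
proof (cases "c = 0")
  case True
  then show ?thesis using add_character_zero[OF assms(1)] by (simp add: card_E)
next
  case False
  obtain y where y: "y \<in> E" "\<psi> y \<noteq> 1" using assms by (auto simp: add_character_def)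
  have "(\<Sum>x\<in>E. \<psi> x) = (\<Sum>x\<in>E. \<psi> (y + x))" by (rule sum_shift[symmetric]) (rule y)
  also have "\<dots> = \<psi> y * (\<Sum>x\<in>E. \<psi> x)"
    using add_character_add[OF assms(1) y(1)] by (simp add: sum_distrib_left)
  finally have "(\<Sum>x\<in>E. \<psi> x) = 0" using y(2) by simp
  then show ?thesis using sum_scale[OF assms(2) False, of \<psi>] False by simp
qed

lemma kloosterman_real:
  assumes "add_character E \<psi>" "a \<in> E"
  shows "kloosterman E \<psi> a \<in> \<real>"
proof -
  have "cnj (kloosterman E \<psi> a) = (\<Sum>x\<in>E - {0}. \<psi> (- (x + a / x)))"
    unfolding kloosterman_def cnj_sum
  proof (rule sum.cong)
    fix x assume "x \<in> E - {0}"
    then have x: "x + a / x \<in> E" using assms by auto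
    show "cnj (\<psi> (x + a / x)) = \<psi> (- (x + a / x))"
      by (rule add_character_minus[OF assms(1) zero_E x minus_E[OF x], symmetric])
  qed simp
  also have "\<dots> = kloosterman E \<psi> a"
    unfolding kloosterman_def
    by (rule sum.reindex_bij_witness[of _ uminus uminus]) auto
  finally show ?thesis by (simp add: Reals_cnj_iff)
qed

lemma mem_square: "x \<in> {x :: 'a. x ^ Q\<^sup>2 = x} \<longleftrightarrow> (x ^ Q) ^ Q = x"
  by (simp add: power2_eq_square power_mult[symmetric])

text \<open>A monic quadratic over \<open>E\<close> has two roots with multiplicity, and they either lie in \<open>E\<close> or are
  swapped by the Frobenius map of the quadratic extension.\<close>

lemma card_split_add_card_nonsplit:
  assumes s: "s \<in> E" and t: "t \<in> E"
  shows "card {(x, y) \<in> E \<times> E. x + y = s \<and> x * y = t}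
    + card {x \<in> {x. x ^ Q\<^sup>2 = x}. x + x ^ Q = s \<and> x * x ^ Q = t} = 2"
proof -
  have "\<exists>r. poly [:t, - s, 1:] r = 0"
    by (rule alg_closed_imp_poly_has_root) simp
  then obtain r1 where r1: "poly [:t, - s, 1:] r1 = 0" by blast
  define r2 where "r2 = s - r1"
  have sum: "r1 + r2 = s" and prod: "r1 * r2 = t"
    using r1 by (simp_all add: r2_def algebra_simps)
  have char: "x + y = s \<and> x * y = t \<longleftrightarrow> (x = r1 \<and> y = r2) \<or> (x = r2 \<and> y = r1)" for x y
  proof
    assume xy: "x + y = s \<and> x * y = t"
    have "(x - r1) * (x - r2) = x * x - (r1 + r2) * x + r1 * r2"
      by (simp add: algebra_simps)
    also have "\<dots> = x * x - (x + y) * x + x * y"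
      using xy sum prod by simp
    also have "\<dots> = 0" by (simp add: algebra_simps)
    finally have "x = r1 \<or> x = r2" by simp
    moreover have "y = r1 + r2 - x" using xy sum by (simp add: eq_diff_eq add.commute)
    ultimately show "(x = r1 \<and> y = r2) \<or> (x = r2 \<and> y = r1)" by auto
  qed (use sum prod in \<open>auto simp: add.commute mult.commute\<close>)
  have "r1 ^ Q + r2 ^ Q = s" "r1 ^ Q * r2 ^ Q = t"
    using s t sum prod frob_add[of r1 r2] power_mult_distrib[of r1 r2 Q] by (simp_all add: mem_E)
  then consider "r1 \<noteq> r2" "r1 ^ Q = r1" "r2 ^ Q = r2" | "r1 \<noteq> r2" "r1 ^ Q = r2" "r2 ^ Q = r1"
    | "r1 = r2" "r1 ^ Q = r1"
    using char[of "r1 ^ Q" "r2 ^ Q"] by blast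
  then show ?thesis
  proof cases
    case 1
    then have A: "{(x, y) \<in> E \<times> E. x + y = s \<and> x * y = t} = {(r1, r2), (r2, r1)}"
      by (auto simp: char mem_E)
    have B: "{x \<in> {x. x ^ Q\<^sup>2 = x}. x + x ^ Q = s \<and> x * x ^ Q = t} = {}"
      using 1 by (auto simp: char mem_E)
    show ?thesis unfolding A B using 1 by simp
  next
    case 2
    then have A: "{(x, y) \<in> E \<times> E. x + y = s \<and> x * y = t} = {}"
      by (auto simp: char mem_E)
    have B: "{x \<in> {x. x ^ Q\<^sup>2 = x}. x + x ^ Q = s \<and> x * x ^ Q = t} = {r1, r2}"
      using 2 unfolding mem_square char by auto
    show ?thesis unfolding A B using 2 by simp
  next
    case 3
    then have A: "{(x, y) \<in> E \<times> E. x + y = s \<and> x * y = t} = {(r1, r1)}"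
      by (auto simp: char mem_E)
    have B: "{x \<in> {x. x ^ Q\<^sup>2 = x}. x + x ^ Q = s \<and> x * x ^ Q = t} = {r1}"
      using 3 unfolding mem_square char by auto
    show ?thesis unfolding A B by simp
  qed
qed

text \<open>The character is composed with the trace of the quadratic extension. It stays nontrivial
  because y / 2 has trace y for y in \<open>E\<close>, the characteristic being odd.\<close>

lemma add_character_lift:
  assumes "add_character E \<psi>"
  shows "add_character {x. x ^ Q\<^sup>2 = x} (\<lambda>x. \<psi> (x + x ^ Q))"
proof -
  have tr: "x + x ^ Q \<in> E" if "(x ^ Q) ^ Q = x" for x
    using that by (simp add: mem_E frob_add add.commute)
  obtain y where y: "y \<in> E" "\<psi> y \<noteq> 1" using assms by (auto simp: add_character_def)
  define z where "z = y / 2"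
  have "z \<in> E" using y by (auto simp: z_def)
  have "z + z ^ Q = z + z" using \<open>z \<in> E\<close> by (simp add: mem_E)
  also have "\<dots> = y" using two_nz by (simp add: z_def flip: mult_2)
  finally have "z + z ^ Q = y" .
  then have "\<psi> (z + z ^ Q) \<noteq> 1" "(z ^ Q) ^ Q = z" using y \<open>z \<in> E\<close> by (auto simp: mem_E)
  moreover have "\<psi> (x + y + (x + y) ^ Q) = \<psi> (x + x ^ Q) * \<psi> (y + y ^ Q)"
    if "(x ^ Q) ^ Q = x" "(y ^ Q) ^ Q = y" for x y
    using add_character_add[OF assms tr tr, OF that] by (simp add: frob_add algebra_simps)
  moreover have "norm (\<psi> (x + x ^ Q)) = 1" if "(x ^ Q) ^ Q = x" for x
    using tr[OF that] assms by (simp add: add_character_def)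
  ultimately show ?thesis
    unfolding add_character_def Ball_def Bex_def mem_square by (intro conjI allI impI exI[of _ z]) simp_all
qed

text \<open>In K^2 a pair (x, y) and in the lifted sum a pair (x, x^Q) contribute
  \<open>\<psi> (s * (1 + a / t))\<close>, which depends only on the sum s and the product t. By
  \<open>card_split_add_card_nonsplit\<close> each (s, t) has total weight 2, and summing over s
  leaves only t = -a.\<close>

lemma kloosterman_lift:
  assumes \<psi>: "add_character E \<psi>" and a: "a \<in> E" "a \<noteq> 0"
  shows "kloosterman {x. x ^ Q\<^sup>2 = x} (\<lambda>x. \<psi> (x + x ^ Q)) a = 2 * of_nat Q - (kloosterman E \<psi> a)\<^sup>2"
proof -
  define E2 where "E2 = {x :: 'a. x ^ Q\<^sup>2 = x}"
  define T where "T = E \<times> (E - {0})"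
  define g where "g = (\<lambda>(s, t). \<psi> (s * (1 + a / t)))"
  have "odd_subfield (Q ^ 2) (k * 2) E2"
    unfolding E2_def by (rule odd_subfield_power[where E = E and Q = Q]) (use odd_subfield_axioms in auto)
  then interpret E2: odd_subfield "Q ^ 2" "k * 2" E2 .
  have kl_add: "x + a / x + (y + a / y) = (x + y) * (1 + a / (x * y))" if "x \<noteq> 0" "y \<noteq> 0" for x y
  proof -
    have "(x + y) * (1 + a / (x * y)) = x + y + a * (x / (x * y)) + a * (y / (x * y))"
      by (simp add: algebra_simps add_divide_distrib)
    then show ?thesis using that by simp
  qed
  have split: "(kloosterman E \<psi> a)\<^sup>2 = (\<Sum>st\<in>T. of_nat (card {(x, y) \<in> E \<times> E. x + y = fst st \<and> x * y = snd st}) * g st)"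
  proof -
    define h where "h = (\<lambda>(x, y). (x + y, x * y :: 'a))"
    have "(kloosterman E \<psi> a)\<^sup>2 = (\<Sum>x\<in>E - {0}. \<Sum>y\<in>E - {0}. \<psi> (x + a / x) * \<psi> (y + a / y))"
      by (simp add: kloosterman_def power2_eq_square sum_product)
    also have "\<dots> = (\<Sum>x\<in>E - {0}. \<Sum>y\<in>E - {0}. g (h (x, y)))"
    proof (intro sum.cong refl)
      fix x y assume xy: "x \<in> E - {0}" "y \<in> E - {0}"
      then have "\<psi> (x + a / x) * \<psi> (y + a / y) = \<psi> (x + a / x + (y + a / y))"
        using a by (intro add_character_add[OF \<psi>, symmetric]) auto
      also have "x + a / x + (y + a / y) = (x + y) * (1 + a / (x * y))"
        using xy by (intro kl_add) auto
      finally show "\<psi> (x + a / x) * \<psi> (y + a / y) = g (h (x, y))"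
        by (simp add: g_def h_def)
    qed
    also have "\<dots> = (\<Sum>z\<in>(E - {0}) \<times> (E - {0}). g (h z))"
      by (simp add: sum.cartesian_product)
    also have "\<dots> = (\<Sum>st\<in>T. \<Sum>z | z \<in> (E - {0}) \<times> (E - {0}) \<and> h z = st. g (h z))"
      by (rule sum.group[symmetric]) (auto simp: T_def h_def)
    also have "\<dots> = (\<Sum>st\<in>T. of_nat (card {(x, y) \<in> E \<times> E. x + y = fst st \<and> x * y = snd st}) * g st)"
    proof (intro sum.cong refl)
      fix st assume st: "st \<in> T"
      then have "{z. z \<in> (E - {0}) \<times> (E - {0}) \<and> h z = st} = {(x, y) \<in> E \<times> E. x + y = fst st \<and> x * y = snd st}"
        by (auto simp: h_def T_def)
      moreover have "(\<Sum>z | z \<in> (E - {0}) \<times> (E - {0}) \<and> h z = st. g (h z))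
          = (\<Sum>z | z \<in> (E - {0}) \<times> (E - {0}) \<and> h z = st. g st)"
        by (rule sum.cong) auto
      ultimately show "(\<Sum>z | z \<in> (E - {0}) \<times> (E - {0}) \<and> h z = st. g (h z))
          = of_nat (card {(x, y) \<in> E \<times> E. x + y = fst st \<and> x * y = snd st}) * g st"
        by simp
    qed
    finally show ?thesis .
  qed
  have nonsplit: "kloosterman E2 (\<lambda>x. \<psi> (x + x ^ Q)) a
      = (\<Sum>st\<in>T. of_nat (card {x \<in> E2. x + x ^ Q = fst st \<and> x * x ^ Q = snd st}) * g st)"
  proof -
    define h where "h x = (x + x ^ Q, x * x ^ Q)" for x :: 'a
    have "kloosterman E2 (\<lambda>x. \<psi> (x + x ^ Q)) a = (\<Sum>x\<in>E2 - {0}. g (h x))"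
      unfolding kloosterman_def
    proof (intro sum.cong refl)
      fix x assume x: "x \<in> E2 - {0}"
      have "(x + a / x) ^ Q = x ^ Q + a / x ^ Q"
        using a by (simp add: mem_E frob_add power_divide)
      moreover have "x + a / x + (x ^ Q + a / x ^ Q) = (x + x ^ Q) * (1 + a / (x * x ^ Q))"
        using x by (intro kl_add) auto
      ultimately have "x + a / x + (x + a / x) ^ Q = (x + x ^ Q) * (1 + a / (x * x ^ Q))"
        by (simp only:)
      then show "\<psi> (x + a / x + (x + a / x) ^ Q) = g (h x)"
        by (simp add: g_def h_def)
    qed
    also have "\<dots> = (\<Sum>st\<in>T. \<Sum>x | x \<in> E2 - {0} \<and> h x = st. g (h x))"
    proof (rule sum.group[symmetric])
      show "finite T" "finite (E2 - {0})" by (simp_all add: T_def)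
      show "h ` (E2 - {0}) \<subseteq> T"
      proof (rule image_subsetI)
        fix x assume "x \<in> E2 - {0}"
        then have "x \<in> E2" "x \<noteq> 0" by auto
        from this(1) have "(x ^ Q) ^ Q = x" using mem_square unfolding E2_def by blast
        then have "x + x ^ Q \<in> E" "x * x ^ Q \<in> E"
          by (simp_all add: mem_E frob_add power_mult_distrib add.commute mult.commute)
        then show "h x \<in> T" using \<open>x \<noteq> 0\<close> by (simp add: T_def h_def)
      qed
    qed
    also have "\<dots> = (\<Sum>st\<in>T. of_nat (card {x \<in> E2. x + x ^ Q = fst st \<and> x * x ^ Q = snd st}) * g st)"
    proof (intro sum.cong refl)
      fix st assume st: "st \<in> T"
      then have "{x. x \<in> E2 - {0} \<and> h x = st} = {x \<in> E2. x + x ^ Q = fst st \<and> x * x ^ Q = snd st}"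
        by (auto simp: h_def T_def)
      moreover have "(\<Sum>x | x \<in> E2 - {0} \<and> h x = st. g (h x)) = (\<Sum>x | x \<in> E2 - {0} \<and> h x = st. g st)"
        by (rule sum.cong) auto
      ultimately show "(\<Sum>x | x \<in> E2 - {0} \<and> h x = st. g (h x))
          = of_nat (card {x \<in> E2. x + x ^ Q = fst st \<and> x * x ^ Q = snd st}) * g st"
        by simp
    qed
    finally show ?thesis .
  qed
  have two: "of_nat m * z + of_nat n * z = 2 * z" if "m + n = 2" for m n and z :: complex
  proof -
    have "of_nat m * z + of_nat n * z = of_nat (m + n) * z" by (simp add: distrib_right)
    then show ?thesis using that by simp
  qed
  have "(kloosterman E \<psi> a)\<^sup>2 + kloosterman E2 (\<lambda>x. \<psi> (x + x ^ Q)) a = (\<Sum>st\<in>T. 2 * g st)"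
    unfolding split nonsplit sum.distrib[symmetric]
  proof (intro sum.cong refl)
    fix st assume "st \<in> T"
    then have "card {(x, y) \<in> E \<times> E. x + y = fst st \<and> x * y = snd st}
        + card {x \<in> E2. x + x ^ Q = fst st \<and> x * x ^ Q = snd st} = 2"
      unfolding E2_def by (intro card_split_add_card_nonsplit) (auto simp: T_def)
    then show "of_nat (card {(x, y) \<in> E \<times> E. x + y = fst st \<and> x * y = snd st}) * g st
        + of_nat (card {x \<in> E2. x + x ^ Q = fst st \<and> x * x ^ Q = snd st}) * g st = 2 * g st"
      by (rule two)
  qed
  also have "\<dots> = 2 * (\<Sum>t\<in>E - {0}. \<Sum>s\<in>E. \<psi> ((1 + a / t) * s))"
  proof -
    have "(\<Sum>st\<in>T. 2 * g st) = 2 * (\<Sum>st\<in>T. g st)"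
      by (rule sum_distrib_left[symmetric])
    also have "(\<Sum>st\<in>T. g st) = (\<Sum>s\<in>E. \<Sum>t\<in>E - {0}. \<psi> (s * (1 + a / t)))"
      unfolding T_def g_def by (rule sum.cartesian_product[symmetric])
    also have "\<dots> = (\<Sum>t\<in>E - {0}. \<Sum>s\<in>E. \<psi> (s * (1 + a / t)))"
      by (rule sum.swap)
    finally show ?thesis by (simp only: mult.commute)
  qed
  also have "\<dots> = 2 * (\<Sum>t\<in>E - {0}. if t = - a then of_nat Q else 0)"
  proof (intro arg_cong[of _ _ "(*) 2"] sum.cong refl)
    fix t assume t: "t \<in> E - {0}"
    then have "1 + a / t = 0 \<longleftrightarrow> t = - a"
      by (auto simp: field_simps eq_neg_iff_add_eq_0)
    moreover have "1 + a / t \<in> E" using t a by auto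
    ultimately show "(\<Sum>s\<in>E. \<psi> ((1 + a / t) * s)) = (if t = - a then of_nat Q else 0)"
      using sum_add_character[OF \<psi>, of "1 + a / t"] by simp
  qed
  also have "\<dots> = 2 * of_nat Q" using a by auto
  finally show ?thesis unfolding E2_def by (simp add: algebra_simps)
qed

end

section \<open>The tower of quadratic extensions\<close>

text \<open>The trace from degree 2^j down to the ground field, as a composition of relative traces
  of quadratic extensions. Since the top step is taken first, one recursion step matches one
  application of \<open>kloosterman_lift\<close>.\<close>

fun tower_trace :: "nat \<Rightarrow> nat \<Rightarrow> 'a :: field \<Rightarrow> 'a" where
  "tower_trace Q 0 x = x"
| "tower_trace Q (Suc j) x = tower_trace Q j (x + x ^ (Q ^ 2 ^ j))"

text \<open>Since (2 + v)^2 - 2 is at least 2 + 4 v, an excess of the absolute value over 2 at least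
  quadruples in each step.\<close>

lemma escape_if_recurrence:
  fixes u :: "nat \<Rightarrow> real"
  assumes "\<And>n. u (Suc n) = 2 - (u n)\<^sup>2"
  shows "2 + \<delta> \<le> \<bar>u 0\<bar> \<Longrightarrow> 0 \<le> \<delta> \<Longrightarrow> 2 + \<delta> * 4 ^ n \<le> \<bar>u n\<bar>"
    and "u (Suc n) \<le> 2"
proof -
  show "2 + \<delta> * 4 ^ n \<le> \<bar>u n\<bar>" if "2 + \<delta> \<le> \<bar>u 0\<bar>" "0 \<le> \<delta>"
  proof (induction n)
    case (Suc n)
    define v where "v = \<delta> * 4 ^ n"
    have "0 \<le> v" using that by (simp add: v_def)
    have "(2 + v)\<^sup>2 \<le> \<bar>u n\<bar>\<^sup>2" using Suc \<open>0 \<le> v\<close> by (intro power_mono) (auto simp: v_def)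
    then have "4 + 4 * v + v\<^sup>2 \<le> (u n)\<^sup>2" by (simp add: power2_sum)
    then have "2 + 4 * v \<le> - u (Suc n)" unfolding assms using zero_le_power2[of v] by linarith
    then show ?case by (simp add: v_def)
  qed (use that in simp)
  show "u (Suc n) \<le> 2" by (simp add: assms)
qed

context odd_subfield
begin

abbreviation tower :: "nat \<Rightarrow> 'a set" where
  "tower j \<equiv> {x. x ^ (Q ^ 2 ^ j) = x}"

lemma odd_subfield_tower: "odd_subfield (Q ^ 2 ^ j) (k * 2 ^ j) (tower j)"
  by (rule odd_subfield_power[OF odd_subfield_axioms]) simp

lemma mem_tower_Suc: "x \<in> tower (Suc j) \<longleftrightarrow> (x ^ (Q ^ 2 ^ j)) ^ (Q ^ 2 ^ j) = x"
proof -
  have "Q ^ 2 ^ Suc j = Q ^ 2 ^ j * Q ^ 2 ^ j" by (simp add: power_add[symmetric] mult_2)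
  then show ?thesis by (simp add: power_mult)
qed

lemma E_subset_tower: "x \<in> E \<Longrightarrow> x \<in> tower j"
proof -
  assume "x \<in> E"
  then have "x ^ Q ^ n = x" for n by (induction n) (auto simp: mem_E power_mult)
  then show ?thesis by simp
qed

lemma tower_trace_linear:
  shows "tower_trace Q j (x + y :: 'a) = tower_trace Q j x + tower_trace Q j y"
    and "b \<in> E \<Longrightarrow> tower_trace Q j (b * x :: 'a) = b * tower_trace Q j x"
proof -
  show "tower_trace Q j (x + y :: 'a) = tower_trace Q j x + tower_trace Q j y"
  proof (induction j arbitrary: x y)
    case (Suc j)
    interpret T: odd_subfield "Q ^ 2 ^ j" "k * 2 ^ j" "tower j" by (rule odd_subfield_tower)
    show ?case by (simp add: T.frob_add Suc flip: add.assoc)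
  qed simp
  show "tower_trace Q j (b * x :: 'a) = b * tower_trace Q j x" if b: "b \<in> E"
  proof (induction j arbitrary: x)
    case (Suc j)
    have "b ^ (Q ^ 2 ^ j) = b" using E_subset_tower[OF b, of j] by simp
    then have "b * x + (b * x) ^ (Q ^ 2 ^ j) = b * (x + x ^ (Q ^ 2 ^ j))"
      by (simp add: power_mult_distrib distrib_left)
    then show ?case by (simp add: Suc)
  qed simp
qed

lemma tower_trace_mem: "x \<in> tower j \<Longrightarrow> tower_trace Q j (x :: 'a) \<in> E"
proof (induction j arbitrary: x)
  case 0 then show ?case by (simp add: mem_E)
next
  case (Suc j)
  interpret T: odd_subfield "Q ^ 2 ^ j" "k * 2 ^ j" "tower j" by (rule odd_subfield_tower)
  have "x + x ^ (Q ^ 2 ^ j) \<in> tower j"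
    using Suc.prems unfolding mem_tower_Suc by (simp add: T.frob_add add.commute)
  then show ?case using Suc.IH by simp
qed

text \<open>The relative traces telescope. On \<open>tower j\<close> the right-hand side is 0, so
  this is the easy half of additive Hilbert 90: the values y^Q - y have trace zero.\<close>

lemma tower_trace_artin_schreier: "tower_trace Q j (x ^ Q - x :: 'a) = x ^ (Q ^ 2 ^ j) - x"
proof (induction j arbitrary: x)
  case (Suc j)
  interpret T: odd_subfield "Q ^ 2 ^ j" "k * 2 ^ j" "tower j" by (rule odd_subfield_tower)
  let ?P = "Q ^ 2 ^ j"
  have comm: "(x ^ Q) ^ ?P = (x ^ ?P) ^ Q" by (metis mult.commute power_mult)
  have "x ^ Q - x + (x ^ Q - x) ^ ?P = (x + x ^ ?P) ^ Q - (x + x ^ ?P)"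
    unfolding T.frob_diff frob_add comm by simp
  then have "tower_trace Q (Suc j) (x ^ Q - x) = (x + x ^ ?P) ^ ?P - (x + x ^ ?P)"
    using Suc[of "x + x ^ ?P"] by (simp only: tower_trace.simps)
  also have "\<dots> = (x ^ ?P) ^ ?P - x" by (simp add: T.frob_add)
  also have "(x ^ ?P) ^ ?P = x ^ (Q ^ 2 ^ Suc j)"
    by (simp add: power_mult[symmetric] power_add[symmetric] mult_2)
  finally show ?case .
qed simp

lemma add_character_tower:
  assumes \<psi>: "add_character E \<psi>" and b: "b \<in> E" "b \<noteq> 0"
  shows "add_character (tower j) (\<lambda>x. \<psi> (tower_trace Q j (b * x)))"
proof (induction j)
  case 0
  have "tower 0 = E" by (simp add: E_eq)
  then show ?case using add_character_scale[OF assms] by simp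
next
  case (Suc j)
  interpret T: odd_subfield "Q ^ 2 ^ j" "k * 2 ^ j" "tower j" by (rule odd_subfield_tower)
  have "{x :: 'a. x ^ (Q ^ 2 ^ j)\<^sup>2 = x} = tower (Suc j)"
    by (simp add: power_mult[symmetric] mult.commute)
  moreover have "b ^ (Q ^ 2 ^ j) = b" using E_subset_tower[OF b(1), of j] by simp
  ultimately show ?case
    using T.add_character_lift[OF Suc] by (simp add: power_mult_distrib distrib_left)
qed

lemma kloosterman_tower_Suc:
  assumes \<psi>: "add_character E \<psi>" and b: "b \<in> E" "b \<noteq> 0" and a: "a \<in> E" "a \<noteq> 0"
  shows "kloosterman (tower (Suc j)) (\<lambda>x. \<psi> (tower_trace Q (Suc j) (b * x))) a
    = 2 * of_nat (Q ^ 2 ^ j) - (kloosterman (tower j) (\<lambda>x. \<psi> (tower_trace Q j (b * x))) a)\<^sup>2"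
proof -
  interpret T: odd_subfield "Q ^ 2 ^ j" "k * 2 ^ j" "tower j" by (rule odd_subfield_tower)
  have 1: "{x :: 'a. x ^ (Q ^ 2 ^ j)\<^sup>2 = x} = tower (Suc j)"
    by (simp add: power_mult[symmetric] mult.commute)
  have "b ^ (Q ^ 2 ^ j) = b" using E_subset_tower[OF b(1), of j] by simp
  then have 2: "tower_trace Q j (b * (x + x ^ (Q ^ 2 ^ j))) = tower_trace Q (Suc j) (b * x)" for x
    by (simp add: power_mult_distrib distrib_left)
  show ?thesis
    using T.kloosterman_lift[OF add_character_tower[OF \<psi> b, of j] E_subset_tower[OF a(1)] a(2)]
    unfolding 1 2 .
qed

text \<open>\<open>f\<close> is the discriminant of x^2 - u x + a with u = y^Q - y, so it decides
  whether u = x + a / x is soluble. For g = X^Q - X the derivative is -1, so that of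
  \<open>f\<close> is -2 g; it is nonzero where g takes a value c with c^2 = 4 a. This provides the
  simple root that \<open>stepanov\<close> asks for.\<close>

lemma artin_schreier_poly:
  fixes a :: 'a
  assumes a: "a \<in> E" "a \<noteq> 0"
  defines "f \<equiv> (monom 1 Q + [:0, - 1:]) ^ 2 - [:4 * a:]"
  shows "coeff f n \<in> E" "degree f \<le> 2 * Q" "poly f y = (y ^ Q - y)\<^sup>2 - 4 * a"
    and "\<exists>\<rho>. order \<rho> f = 1"
proof -
  define g where "g = monom 1 Q + [:0, - 1 :: 'a:]"
  have four: "(4 :: 'a) \<noteq> 0" using two_nz mult_eq_0_iff[of "2 :: 'a" 2] by simp
  have deg_g: "degree g = Q"
    unfolding g_def using Q_gt_2 by (subst degree_add_eq_left) (simp_all add: degree_monom_eq)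
  have poly_g: "poly g y = y ^ Q - y" for y by (simp add: g_def poly_monom)
  have der_g: "pderiv g = - 1"
    using of_nat_Q by (simp add: g_def pderiv_add pderiv_monom pderiv_pCons one_pCons)
  have f: "f = g ^ 2 - [:4 * a:]" by (simp add: f_def g_def)
  have coeff_g: "coeff g m \<in> E" for m
    unfolding g_def coeff_add by (intro add_E) (auto simp: coeff_pCons split: nat.split)
  have "coeff [:4 * a:] n \<in> E" using a by (auto simp: coeff_pCons split: nat.split)
  then show "coeff f n \<in> E"
    unfolding f coeff_diff by (intro diff_E coeff_power_E coeff_g)
  show "degree f \<le> 2 * Q"
    unfolding f by (rule degree_diff_le) (use degree_power_le[of g 2] deg_g in auto)
  show "poly f y = (y ^ Q - y)\<^sup>2 - 4 * a"
    by (simp add: f poly_g)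
  obtain c where c: "c ^ 2 = 4 * a" using nth_root_exists[of 2 "4 * a"] by auto
  have "degree (g - [:c:]) > 0"
    using deg_g Q_gt_2 by (subst diff_conv_add_uminus, subst degree_add_eq_left) auto
  then obtain \<rho> where "poly (g - [:c:]) \<rho> = 0" using alg_closed_imp_poly_has_root by blast
  then have \<rho>: "poly g \<rho> = c" by simp
  have "poly f \<rho> = 0" using \<rho> c by (simp add: f)
  moreover have "poly (pderiv f) \<rho> = - (2 * c)"
    using \<rho> der_g by (simp add: f pderiv_diff pderiv_power power2_eq_square pderiv_mult pderiv_pCons)
  then have "poly (pderiv f) \<rho> \<noteq> 0" using two_nz c a four by auto
  ultimately show "\<exists>\<rho>. order \<rho> f = 1" using order_eq_1_if_simple_root by blast
qed

text \<open>The trace is linear over \<open>E\<close>, so b factors out of it, and orthogonality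
  over b detects trace zero. The term b = 0 carries the main term of the count.\<close>

lemma sum_kloosterman_tower:
  assumes \<psi>: "add_character E \<psi>" and a: "a \<in> E"
  shows "(\<Sum>b\<in>E. kloosterman (tower j) (\<lambda>x. \<psi> (tower_trace Q j (b * x))) a)
    = of_nat (Q * card {x \<in> tower j - {0}. tower_trace Q j (x + a / x) = 0})"
proof -
  interpret T: odd_subfield "Q ^ 2 ^ j" "k * 2 ^ j" "tower j" by (rule odd_subfield_tower)
  have "(\<Sum>b\<in>E. kloosterman (tower j) (\<lambda>x. \<psi> (tower_trace Q j (b * x))) a)
      = (\<Sum>x\<in>tower j - {0}. \<Sum>b\<in>E. \<psi> (tower_trace Q j (b * (x + a / x))))"
    unfolding kloosterman_def by (rule sum.swap)
  also have "\<dots> = (\<Sum>x\<in>tower j - {0}. if tower_trace Q j (x + a / x) = 0 then of_nat Q else 0)"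
  proof (rule sum.cong[OF refl])
    fix x assume "x \<in> tower j - {0}"
    then have "x + a / x \<in> tower j" using E_subset_tower[OF a, of j] by (intro T.add_E T.divide_E) auto
    then have "tower_trace Q j (x + a / x) \<in> E" by (rule tower_trace_mem)
    then have "(\<Sum>b\<in>E. \<psi> (tower_trace Q j (x + a / x) * b))
        = (if tower_trace Q j (x + a / x) = 0 then of_nat Q else 0)"
      by (rule sum_add_character[OF \<psi>])
    moreover have "(\<Sum>b\<in>E. \<psi> (tower_trace Q j (b * (x + a / x))))
        = (\<Sum>b\<in>E. \<psi> (tower_trace Q j (x + a / x) * b))"
      by (rule sum.cong[OF refl]) (simp only: tower_trace_linear(2) mult.commute)
    ultimately show "(\<Sum>b\<in>E. \<psi> (tower_trace Q j (b * (x + a / x))))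
        = (if tower_trace Q j (x + a / x) = 0 then of_nat Q else 0)"
      by (simp only:)
  qed
  also have "\<dots> = (\<Sum>x\<in>{x \<in> tower j - {0}. tower_trace Q j (x + a / x) = 0}. of_nat Q)"
    by (rule sum.inter_filter[symmetric]) (use T.finite_E in simp)
  finally show ?thesis by (simp only: sum_constant of_nat_mult mult.commute)
qed

text \<open>Euler's criterion: c^((Q - 1) / 2) squares to 1, so excluding -1 forces 1, and then a
  square root taken in the ambient closed field is fixed by Frobenius.\<close>

lemma card_square_roots:
  assumes c: "c \<in> E" "c \<noteq> 0" "c ^ ((Q - 1) div 2) \<noteq> - 1"
  shows "card {z \<in> E. z\<^sup>2 = c} = 2"
proof -
  define h where "h = (Q - 1) div 2"
  have Q: "Q = Suc (2 * h)" using odd_Q Q_gt_2 by (auto simp: h_def elim: oddE)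
  have "c * (c ^ h)\<^sup>2 = c"
    using c(1) unfolding mem_E by (simp add: Q power_mult[symmetric] mult.commute)
  then have "(c ^ h)\<^sup>2 = 1" using c(2) by simp
  then have ch: "c ^ h = 1" using c(3) by (auto simp: h_def power2_eq_1_iff)
  obtain w where w: "w\<^sup>2 = c" using nth_root_exists[of 2 c] by auto
  have "w ^ Q = w * (w\<^sup>2) ^ h" by (simp add: Q power_mult[symmetric])
  then have "w \<in> E" by (simp add: w ch mem_E)
  have "w \<noteq> 0" using w c by auto
  then have "w \<noteq> - w" using two_nz by (simp add: eq_neg_iff_add_eq_0 flip: mult_2)
  moreover have "{z \<in> E. z\<^sup>2 = c} = {w, - w}"
    using \<open>w \<in> E\<close> by (auto simp: w[symmetric] power2_eq_iff)
  ultimately show ?thesis by simp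
qed

lemma finite_artin_schreier_fibre: "finite {y :: 'a. y ^ Q - y = c}"
proof -
  have sub: "{y. y ^ Q - y = c} \<subseteq> {y. poly (monom 1 Q + [:- c, - 1:]) y = 0}"
    by (auto simp: poly_monom)
  have "degree (monom 1 Q + [:- c, - 1:]) = Q"
    using Q_gt_2 by (subst degree_add_eq_left) (simp_all add: degree_monom_eq)
  then have "monom 1 Q + [:- c, - 1:] \<noteq> 0" using Q_gt_2 by auto
  then show ?thesis by (rule finite_subset[OF sub poly_roots_finite])
qed

lemma card_artin_schreier_fibre: "card {y :: 'a. y ^ Q - y = c} \<le> Q"
proof (cases "{y. y ^ Q - y = c} = {}")
  case False
  then obtain y0 where "y0 ^ Q - y0 = c" by blast
  then have "(\<lambda>y. y - y0) ` {y. y ^ Q - y = c} \<subseteq> E"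
    by (auto simp: mem_E frob_diff algebra_simps)
  then have "card ((\<lambda>y. y - y0) ` {y. y ^ Q - y = c}) \<le> card E"
    by (intro card_mono) auto
  moreover have "card ((\<lambda>y. y - y0) ` {y. y ^ Q - y = c}) = card {y. y ^ Q - y = c}"
    by (intro card_image) (auto simp: inj_on_def)
  ultimately show ?thesis by (simp add: card_E)
qed simp

text \<open>The points of \<open>y\<^sup>q - y = x + a / x\<close> are parametrised by those of
  \<open>z\<^sup>2 = (y\<^sup>q - y)\<^sup>2 - 4 a\<close> via \<open>z = x - a / x\<close>.\<close>

lemma card_tower_trace_zero_ge:
  assumes a: "a \<in> E" "a \<noteq> 0" and i: "2 \<le> i"
  defines "s \<equiv> Q ^ 2 ^ i"
  shows "s\<^sup>2 \<le> Q * card {x \<in> tower (Suc i) - {0}. tower_trace Q (Suc i) (x + a / x) = 0} + 10 * Q * s"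
proof -
  define P where "P = tower (Suc i)"
  define V :: "'a set" where "V = {x \<in> P - {0}. tower_trace Q (Suc i) (x + a / x) = 0}"
  define f :: "'a poly" where "f = (monom 1 Q + [:0, - 1:]) ^ 2 - [:4 * a:]"
  note f = artin_schreier_poly[OF a, folded f_def]
  have sq: "Q ^ 2 ^ Suc i = s\<^sup>2" by (simp add: s_def power_mult[symmetric] mult.commute)
  have "odd_subfield (s\<^sup>2) (k * 2 ^ Suc i) P"
    using odd_subfield_tower[of "Suc i"] unfolding sq P_def .
  then interpret T: odd_subfield "s\<^sup>2" "k * 2 ^ Suc i" P .
  have P_eq: "P = {x. x ^ s\<^sup>2 = x}" unfolding P_def sq ..
  have EP: "x \<in> P" if "x \<in> E" for x using E_subset_tower[OF that] unfolding P_def .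
  have four: "(4 :: 'a) \<noteq> 0" using two_nz mult_eq_0_iff[of "2 :: 'a" 2] by simp
  have "odd s" using odd_Q by (simp add: s_def)
  then obtain r where r: "s = 2 * r + 1" by (auto elim: oddE)
  \<comment> \<open>The assumption \<open>2 \<le> i\<close> gives Q^4 <= s, which is ample for the
    condition \<open>2 * d \<le> r\<close> of \<open>stepanov\<close> with d = Q.\<close>
  have "2 * Q \<le> r" "0 < r"
  proof -
    have "Q ^ 4 \<le> s" unfolding s_def
      using i Q_gt_2 power_increasing[of 2 i "2 :: nat"] by (intro power_increasing) auto
    moreover have "27 * Q \<le> Q ^ 4"
    proof -
      have "3 ^ 3 \<le> Q ^ 3" using Q_gt_2 by (intro power_mono) auto
      then have "3 ^ 3 * Q \<le> Q ^ 3 * Q" by (rule mult_right_mono) simp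
      then show ?thesis by (simp add: power3_eq_cube power4_eq_xxxx)
    qed
    ultimately show "2 * Q \<le> r" "0 < r" using r Q_gt_2 by linarith+
  qed
  have half: "(s\<^sup>2 - 1) div 2 = 2 * r\<^sup>2 + 2 * r"
    unfolding r by (simp add: power2_eq_square algebra_simps)
  have s2: "s\<^sup>2 = 2 * (2 * r\<^sup>2 + 2 * r) + 1"
    unfolding r by (simp add: power2_eq_square algebra_simps)
  \<comment> \<open>Outside the roots \<open>B1\<close> of \<open>f\<close> and the points
    \<open>B2\<close> with nonsquare value, each y in \<open>P\<close> carries exactly two
    z.\<close>
  define B1 where "B1 = {y. poly f y = 0}"
  define B2 where "B2 = {y. y ^ s\<^sup>2 = y \<and> poly f y ^ (2 * r\<^sup>2 + 2 * r) = - 1}"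
  define D where "D = P - (B1 \<union> B2)"
  obtain \<rho> where \<rho>: "order \<rho> f = 1" using f(4) by blast
  have f0: "poly f 0 \<noteq> 0" 
  proof -
    have "poly f 0 = - (4 * a)" unfolding f(3) using Q_gt_2 by (simp add: power_0_left)
    then show ?thesis using a four by simp
  qed
  then have "f \<noteq> 0" by auto
  have "card B1 \<le> 2 * Q"
    using card_poly_roots_bound[OF \<open>f \<noteq> 0\<close>] f(2) by (simp add: B1_def)
  moreover have "card B2 \<le> 2 * r\<^sup>2 + 2 * r + 3 * Q * s"
    unfolding B2_def
    by (rule stepanov[OF f(1,2) f0 \<rho> _ _ r \<open>2 * Q \<le> r\<close> \<open>0 < r\<close>]) (auto simp: s_def)
  moreover have "card P - card (B1 \<union> B2) \<le> card D"
    unfolding D_def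
  proof (rule diff_card_le_card_Diff)
    have "B2 \<subseteq> P" by (auto simp: B2_def P_eq)
    then have "finite B2" by (rule finite_subset) (rule T.finite_E)
    then show "finite (B1 \<union> B2)" using poly_roots_finite[OF \<open>f \<noteq> 0\<close>] by (simp add: B1_def)
  qed
  moreover have "card (B1 \<union> B2) \<le> card B1 + card B2" by (rule card_Un_le)
  ultimately have "s\<^sup>2 \<le> card D + (2 * Q + (2 * r\<^sup>2 + 2 * r + 3 * Q * s))"
    unfolding T.card_E by linarith
  then have "s\<^sup>2 \<le> card D + (2 * Q + (2 * r\<^sup>2 + 2 * r + 3 * (Q * s)))"
    by (simp only: mult.assoc)
  \<comment> \<open>Stepanov's main term is m = (s^2 - 1) / 2, so after doubling it is absorbed by
    s^2 = 2 m + 1. The constants 4 and 6 later merge into 10 by Q <= Q s.\<close>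
  moreover have "v \<le> 2 * c + 4 * q + 6 * t" if "v \<le> c + (2 * q + (m + 3 * t))" "v = 2 * m + 1"
    for v c q t m :: nat using that by linarith
  ultimately have cD: "s\<^sup>2 \<le> 2 * card D + 4 * Q + 6 * (Q * s)"
    using s2 by blast
  define Z where "Z = (SIGMA y:P. {z \<in> P. z\<^sup>2 = poly f y})"
  define W where "W = (SIGMA x:V. {y. y ^ Q - y = x + a / x})"
  have "2 * card D = (\<Sum>y\<in>D. card {z \<in> P. z\<^sup>2 = poly f y})"
  proof -
    have "card {z \<in> P. z\<^sup>2 = poly f y} = 2" if "y \<in> D" for y
    proof (rule T.card_square_roots)
      have y: "y \<in> P" using that by (auto simp: D_def)
      have "4 * a \<in> P" using EP[OF a(1)] by auto
      then show "poly f y \<in> P" unfolding f(3) using y by (intro T.diff_E T.power_E) auto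
      show "poly f y \<noteq> 0" using that by (auto simp: D_def B1_def)
      show "poly f y ^ ((s\<^sup>2 - 1) div 2) \<noteq> - 1"
        using that y unfolding half by (auto simp: D_def B2_def P_eq)
    qed
    then show ?thesis by simp
  qed
  also have "\<dots> \<le> (\<Sum>y\<in>P. card {z \<in> P. z\<^sup>2 = poly f y})"
    by (rule sum_mono2) (auto simp: D_def)
  also have "\<dots> = card Z" by (simp add: Z_def)
  \<comment> \<open>With u = y^Q - y, the first component of the map solves u = x + a / x, z = x - a
    / x for x; keeping y as second component makes the map injective.\<close>
  also have "card Z \<le> card W"
  proof (rule card_inj_on_le[where f = "\<lambda>(y, z). ((y ^ Q - y + z) / 2, y)"])
    show "inj_on (\<lambda>(y, z). ((y ^ Q - y + z) / 2, y)) Z"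
      using two_nz by (auto simp: inj_on_def)
    show "(\<lambda>(y, z). ((y ^ Q - y + z) / 2, y)) ` Z \<subseteq> W"
    proof (rule image_subsetI, clarify)
      fix y z assume "(y, z) \<in> Z"
      then have yz: "y \<in> P" "z \<in> P" "z\<^sup>2 = (y ^ Q - y)\<^sup>2 - 4 * a" by (auto simp: Z_def f(3))
      define u where "u = y ^ Q - y"
      define x where "x = (u + z) / 2"
      have "4 * (x * (u - x)) = (2 * x) * (2 * u - 2 * x)" by (simp add: algebra_simps)
      also have "2 * x = u + z" using two_nz by (simp add: x_def)
      also have "(u + z) * (2 * u - (u + z)) = u\<^sup>2 - z\<^sup>2" by (simp add: algebra_simps power2_eq_square)
      also have "\<dots> = 4 * a" using yz(3) by (simp add: u_def)
      finally have xa: "x * (u - x) = a" using four by simp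
      then have "x \<noteq> 0" using a by auto
      then have ux: "u = x + a / x" using xa by (simp add: field_simps)
      have "x \<in> P" using yz(1,2) unfolding x_def u_def by auto
      moreover have "tower_trace Q (Suc i) u = 0"
        using yz(1) by (simp only: u_def tower_trace_artin_schreier P_def mem_Collect_eq) simp
      ultimately have "x \<in> V" using \<open>x \<noteq> 0\<close> ux by (simp add: V_def)
      then show "((y ^ Q - y + z) / 2, y) \<in> W"
        using ux by (simp add: W_def x_def u_def)
    qed
    show "finite W" unfolding W_def V_def by (intro finite_SigmaI finite_artin_schreier_fibre) auto
  qed
  also have "card W \<le> (\<Sum>x\<in>V. Q)"
  proof -
    have "card W = (\<Sum>x\<in>V. card {y. y ^ Q - y = x + a / x})"
      unfolding W_def V_def by (subst card_SigmaI) (auto intro: finite_artin_schreier_fibre)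
    then show ?thesis using card_artin_schreier_fibre by (simp only: sum_mono)
  qed
  finally have "2 * card D \<le> Q * card V" by (simp add: mult.commute)
  moreover have "Q \<le> Q * s" using r by simp
  ultimately have "s\<^sup>2 \<le> Q * card V + 10 * (Q * s)" using cD by linarith
  then show ?thesis unfolding V_def P_def by (simp only: mult.assoc)
qed

end

section \<open>The Weil bound for Kloosterman sums\<close>

context odd_subfield
begin

text \<open>With \<open>u\<^sub>j(b) = K\<^sub>j(b) / q\<^bsup>2^j / 2\<^esup>\<close> the doubling formula reads \<open>u\<^sub>j\<^sub>+\<^sub>1 = 2 - u\<^sub>j\<^sup>2\<close>. A value
  \<open>\<bar>u\<^sub>0\<bar> > 2\<close> would escape to minus infinity, all other \<open>u\<^sub>j\<close> being at most 2 for \<open>j > 0\<close>, so the sum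
  over \<open>b\<close> would contradict the point count.\<close>

lemma norm_kloosterman_le:
  assumes \<psi>: "add_character E \<psi>" and a: "a \<in> E" "a \<noteq> 0"
  shows "norm (kloosterman E \<psi> a) \<le> 2 * sqrt Q"
proof (rule ccontr)
  define K where "K j b = kloosterman (tower j) (\<lambda>x. \<psi> (tower_trace Q j (b * x))) a" for j b
  define u where "u b j = Re (K j b) / sqrt Q ^ 2 ^ j" for b j
  have sq_pos: "sqrt (real Q) > 0" using Q_gt_2 by simp
  have sq: "(sqrt (real Q) ^ 2 ^ j)\<^sup>2 = real (Q ^ 2 ^ j)" for j
    by (simp add: power_mult[symmetric] mult.commute[of _ 2] power_mult)
  have sq_Suc: "sqrt (real Q) ^ 2 ^ Suc j = real (Q ^ 2 ^ j)" for j
    by (simp add: power_mult)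
  have real: "K j b = of_real (Re (K j b))" if "b \<in> E" "b \<noteq> 0" for j b
  proof -
    interpret T: odd_subfield "Q ^ 2 ^ j" "k * 2 ^ j" "tower j" by (rule odd_subfield_tower)
    show ?thesis
      using T.kloosterman_real[OF add_character_tower[OF \<psi> that] E_subset_tower[OF a(1)]]
      by (simp add: K_def of_real_Re)
  qed
  have rec: "u b (Suc j) = 2 - (u b j)\<^sup>2" if b: "b \<in> E" "b \<noteq> 0" for b j
  proof -
    have "K (Suc j) b = 2 * of_nat (Q ^ 2 ^ j) - (K j b)\<^sup>2"
      unfolding K_def by (rule kloosterman_tower_Suc[OF \<psi> b a])
    also have "\<dots> = of_real (2 * real (Q ^ 2 ^ j) - (Re (K j b))\<^sup>2)"
      by (subst real[OF b]) simp
    finally have "Re (K (Suc j) b) = 2 * real (Q ^ 2 ^ j) - (Re (K j b))\<^sup>2"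
      by (simp only: Re_complex_of_real)
    then have "u b (Suc j) = (2 * real (Q ^ 2 ^ j) - (Re (K j b))\<^sup>2) / real (Q ^ 2 ^ j)"
      by (simp only: u_def sq_Suc)
    also have "\<dots> = 2 - (Re (K j b))\<^sup>2 / (sqrt (real Q) ^ 2 ^ j)\<^sup>2"
      unfolding sq using Q_gt_2 by (simp add: diff_divide_distrib)
    finally show ?thesis by (simp only: u_def power_divide)
  qed
  have K1: "K 0 1 = kloosterman E \<psi> a" by (simp add: K_def E_eq)
  assume "\<not> norm (kloosterman E \<psi> a) \<le> 2 * sqrt Q"
  then have "2 * sqrt Q < \<bar>Re (K 0 1)\<bar>"
    using real[of 1 0] K1 by (metis norm_of_real not_le one_E zero_neq_one)
  then have "2 < \<bar>u 1 0\<bar>" using sq_pos by (simp add: u_def field_simps)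
  define \<delta> where "\<delta> = \<bar>u 1 0\<bar> - 2"
  have \<delta>: "0 < \<delta>" using \<open>2 < \<bar>u 1 0\<bar>\<close> by (simp add: \<delta>_def)
  \<comment> \<open>Here 12 = 10 + 2: 10 is the error constant of the point count, and each of the
    other nontrivial characters, fewer than Q in number, contributes at most 2. The right side is
    independent of i, so \<open>\<delta>\<close> cannot be positive.\<close>
  have bound: "\<delta> * 4 ^ Suc i \<le> 12 * real Q" if i: "2 \<le> i" for i
  proof -
    define s where "s = Q ^ 2 ^ i"
    have s: "0 < real s" using Q_gt_2 by (simp add: s_def)
    have u_eq: "u b (Suc i) = Re (K (Suc i) b) / real s" for b
      unfolding u_def sq_Suc s_def ..
    have le2: "u b (Suc i) \<le> 2" if "b \<in> E - {0}" for b
      using escape_if_recurrence(2)[of "u b"] rec that by blast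
    have "2 + \<delta> * 4 ^ Suc i \<le> \<bar>u 1 (Suc i)\<bar>"
      by (rule escape_if_recurrence(1)) (use rec \<delta> in \<open>auto simp: \<delta>_def\<close>)
    moreover have "0 < \<delta> * 4 ^ Suc i" using \<delta> by simp
    moreover have "u 1 (Suc i) \<le> 2" by (rule le2) simp
    ultimately have u1: "u 1 (Suc i) \<le> - (\<delta> * 4 ^ Suc i)"
      by linarith
    have E0: "E = insert 0 (E - {0})" "E - {0} = insert 1 (E - {0, 1})" by auto
    have "real (s\<^sup>2) \<le> (\<Sum>b\<in>E. Re (K (Suc i) b)) + 10 * real Q * real s"
    proof -
      have "(\<Sum>b\<in>E. Re (K (Suc i) b)) = Re (\<Sum>b\<in>E. K (Suc i) b)" by simp
      also have "\<dots> = real (Q * card {x \<in> tower (Suc i) - {0}. tower_trace Q (Suc i) (x + a / x) = 0})"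
        unfolding K_def sum_kloosterman_tower[OF \<psi> a(1)] by simp
      moreover have "real (s\<^sup>2) \<le> real (Q * card {x \<in> tower (Suc i) - {0}. tower_trace Q (Suc i) (x + a / x) = 0} + 10 * Q * s)"
        using card_tower_trace_zero_ge[OF a i] unfolding s_def by (simp only: of_nat_le_iff)
      ultimately show ?thesis by simp
    qed
    also have "(\<Sum>b\<in>E. Re (K (Suc i) b)) = Re (K (Suc i) 0) + (\<Sum>b\<in>E - {0}. Re (K (Suc i) b))"
      by (rule sum.remove) auto
    \<comment> \<open>The trivial character contributes s^2 - 1 and so cancels the main term of the
      point count, leaving an estimate for the nontrivial characters alone.\<close>
    also have "Re (K (Suc i) 0) = real (s\<^sup>2) - 1"
    proof -
      interpret T: odd_subfield "Q ^ 2 ^ Suc i" "k * 2 ^ Suc i" "tower (Suc i)" by (rule odd_subfield_tower)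
      have "tower_trace Q (Suc i) (0 :: 'a) = 0"
        using tower_trace_linear(2)[OF zero_E, of "Suc i" 0] by (simp only: mult_zero_left)
      then have "K (Suc i) 0 = of_nat (card (tower (Suc i) - {0}))"
        using add_character_zero[OF \<psi> zero_E] by (simp only: K_def kloosterman_def mult_zero_left) simp
      moreover have "card (tower (Suc i) - {0}) = s\<^sup>2 - 1"
        using T.card_E T.zero_E T.finite_E by (simp add: s_def power_mult[symmetric] mult.commute)
      moreover have "1 \<le> s\<^sup>2" using s by simp
      ultimately show ?thesis by (simp add: of_nat_diff)
    qed
    finally have "1 - 10 * real Q * real s \<le> (\<Sum>b\<in>E - {0}. Re (K (Suc i) b))" by simp
    also have "\<dots> = real s * (\<Sum>b\<in>E - {0}. u b (Suc i))"
      using s by (simp add: u_eq sum_distrib_left)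
    finally have "real s * (- 10 * real Q) \<le> real s * (\<Sum>b\<in>E - {0}. u b (Suc i))"
      by (simp add: mult_ac)
    then have "- 10 * real Q \<le> (\<Sum>b\<in>E - {0}. u b (Suc i))"
      using s by (simp only: mult_le_cancel_left_pos)
    also have "\<dots> = u 1 (Suc i) + (\<Sum>b\<in>E - {0} - {1}. u b (Suc i))"
      by (rule sum.remove) auto
    also have "\<dots> \<le> - (\<delta> * 4 ^ Suc i) + (\<Sum>b\<in>E - {0} - {1}. 2)"
      using u1 le2 by (intro add_mono sum_mono) auto
    also have "(\<Sum>b\<in>E - {0} - {1}. 2) \<le> 2 * real Q"
    proof -
      have "card (E - {0} - {1}) \<le> Q" using card_mono[of E "E - {0} - {1}"] by (auto simp: card_E)
      then show ?thesis by simp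
    qed
    finally show ?thesis by linarith
  qed
  obtain n where n: "12 * real Q / \<delta> < 4 ^ n"
    using real_arch_pow[of 4 "12 * real Q / \<delta>"] by auto
  have "12 * real Q < \<delta> * 4 ^ n" using n \<delta> by (simp add: field_simps)
  also have "\<dots> \<le> \<delta> * 4 ^ Suc (n + 2)"
    using \<delta> by (intro mult_left_mono power_increasing) auto
  also have "\<dots> \<le> 12 * real Q" by (rule bound) simp
  finally show False by simp
qed

text \<open>The character is the absolute trace to the prime field followed by n -> e^(2 pi i n /
  p). The trace is not identically zero on \<open>E\<close>: as a polynomial it has degree at most
  p^(k - 1), less than the order of \<open>E\<close>.\<close>

lemma exists_add_character: "\<exists>\<psi>. add_character E \<psi>"
proof -
  define p where "p = CHAR('a)"
  have p: "prime p" "1 < p" using prime_char prime_gt_1_nat by (auto simp: p_def)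
  define Tr where "Tr x = (\<Sum>i<k. x ^ p ^ i)" for x :: 'a
  define F where "F = {x :: 'a. x ^ p = x}"
  interpret F: odd_subfield p 1 F
    by unfold_locales (use prime_char odd_char in \<open>auto simp: F_def p_def\<close>)
  have Tr_add: "Tr (x + y) = Tr x + Tr y" for x y
    unfolding Tr_def using freshmans_dream'[OF prime_char refl, of x y] by (simp add: p_def sum.distrib)
  have "of_nat ` {..<p} \<subseteq> F" by auto
  moreover have inj: "inj_on (of_nat :: nat \<Rightarrow> 'a) {..<p}"
    unfolding p_def by (rule inj_on_of_nat_CHAR)
  ultimately have F_eq: "of_nat ` {..<p} = F"
    by (intro card_subset_eq) (auto simp: card_image F.card_E)
  define idx where "idx x = (THE i. i < p \<and> of_nat i = x)" for x :: 'a
  have idx: "idx x < p \<and> of_nat (idx x) = x" if "x \<in> F" for x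
    unfolding idx_def
  proof (rule theI')
    show "\<exists>!i. i < p \<and> of_nat i = x" using that inj unfolding F_eq[symmetric] by (auto dest: inj_onD)
  qed
  define e where "e n = cis (2 * pi * real n / real p)" for n
  have e_add: "e (m + n) = e m * e n" for m n
    by (simp add: e_def cis_mult add_divide_distrib distrib_left)
  have e_period: "e (n + p * m) = e n" for n m
  proof -
    have "2 * pi * real (n + p * m) / real p = 2 * pi * real n / real p + 2 * pi * real m"
      using p by (simp add: field_simps)
    then have "e (n + p * m) = e n * cis (2 * pi * real m)" by (simp only: e_def cis_mult)
    then show ?thesis using cis_multiple_2pi[of "real m"] by simp
  qed
  \<comment> \<open>The representatives \<open>idx\<close> below p are additive only modulo p; the
    periodicity of \<open>e\<close> compensates for this.\<close>
  have e_cong: "e m = e n" if "of_nat m = (of_nat n :: 'a)" for m n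
  proof -
    have *: "e m = e n" if "m \<le> n" "of_nat m = (of_nat n :: 'a)" for m n
    proof -
      have "of_nat (n - m) = (0 :: 'a)" using that by (simp add: of_nat_diff)
      then have "p dvd n - m" by (simp add: of_nat_eq_0_iff_char_dvd p_def)
      then obtain c where "n - m = p * c" by (elim dvdE)
      then have "n = m + p * c" using that by linarith
      then show ?thesis by (simp add: e_period)
    qed
    show ?thesis
    proof (cases "m \<le> n")
      case True
      then show ?thesis using that by (rule *)
    next
      case False
      then show ?thesis using *[of n m, OF _ that[symmetric]] by (simp only: nat_le_linear)
    qed
  qed
  define \<psi> where "\<psi> x = e (idx (Tr x))" for x
  have Tr_F: "Tr x \<in> F" if "x \<in> E" for x
  proof -
    have "Tr x ^ p = (\<Sum>i<k. (x ^ p ^ i) ^ p)"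
      unfolding Tr_def by (rule freshmans_dream_sum[OF prime_char p_def])
    also have "\<dots> = (\<Sum>i<k. x ^ p ^ Suc i)" by (simp add: power_mult[symmetric] mult.commute)
    also have "\<dots> = Tr x"
    proof -
      have "(\<Sum>i<k. x ^ p ^ Suc i) + x ^ p ^ 0 = (\<Sum>i<Suc k. x ^ p ^ i)" by (simp only: sum.lessThan_Suc_shift add.commute)
      also have "\<dots> = Tr x + x ^ p ^ k" by (simp add: Tr_def)
      also have "x ^ p ^ k = x" using that by (simp add: mem_E Q_eq p_def)
      finally show ?thesis by simp
    qed
    finally show ?thesis by (simp add: F_def)
  qed
  have "\<exists>x\<in>E. Tr x \<noteq> 0"
  proof (rule ccontr)
    assume "\<not> (\<exists>x\<in>E. Tr x \<noteq> 0)"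
    define t where "t = (\<Sum>i<k. monom (1 :: 'a) (p ^ i))"
    have "coeff t 1 = (\<Sum>i<k. if i = 0 then 1 else 0)"
      unfolding t_def coeff_sum using p by (intro sum.cong) auto
    then have "coeff t 1 = 1" using k_pos by simp
    then have t0: "t \<noteq> 0" by auto
    have "degree t \<le> p ^ (k - 1)"
      unfolding t_def by (intro degree_sum_le) (use p in \<open>auto simp: degree_monom_eq intro!: power_increasing\<close>)
    moreover have "E \<subseteq> {x. poly t x = 0}"
      using \<open>\<not> (\<exists>x\<in>E. Tr x \<noteq> 0)\<close> by (auto simp: t_def Tr_def poly_sum poly_monom)
    then have "card E \<le> degree t"
      using card_mono[of "{x. poly t x = 0}" E] card_poly_roots_bound[OF t0] poly_roots_finite[OF t0] by auto
    moreover have "p ^ (k - 1) < p ^ k" using p k_pos by (intro power_strict_increasing) auto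
    ultimately show False by (simp add: card_E Q_eq p_def)
  qed
  then obtain x where x: "x \<in> E" "Tr x \<noteq> 0" by blast
  have "\<psi> x \<noteq> 1"
  proof
    assume "\<psi> x = 1"
    define n where "n = idx (Tr x)"
    have n: "n < p" "0 < n" using idx[OF Tr_F[OF x(1)]] x(2) by (auto simp: n_def intro: Nat.gr0I)
    have "cos (2 * pi * real n / real p) = 1"
      using \<open>\<psi> x = 1\<close> by (simp add: \<psi>_def e_def n_def[symmetric] complex_eq_iff)
    then obtain m :: int where "2 * pi * real n / real p = of_int m * 2 * pi"
      using cos_one_2pi_int by auto
    then have "real n = of_int m * real p" using p by (simp add: field_simps)
    then have "int n = m * int p" by (metis of_int_eq_iff of_int_mult of_int_of_nat_eq)
    then have "int p dvd int n" by simp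
    then have "p dvd n" by simp
    then show False using n by (auto dest: dvd_imp_le)
  qed
  moreover have "\<psi> (x + y) = \<psi> x * \<psi> y" if "x \<in> E" "y \<in> E" for x y
  proof -
    have "of_nat (idx (Tr x + Tr y)) = (of_nat (idx (Tr x) + idx (Tr y)) :: 'a)"
      using idx Tr_F[OF that(1)] Tr_F[OF that(2)] F.add_E by simp
    then have "e (idx (Tr x + Tr y)) = e (idx (Tr x) + idx (Tr y))" by (rule e_cong)
    then show ?thesis by (simp only: \<psi>_def Tr_add e_add)
  qed
  moreover have "norm (\<psi> x) = 1" for x by (simp add: \<psi>_def e_def)
  ultimately have "add_character E \<psi>"
    unfolding add_character_def Ball_def Bex_def using x(1) by (intro conjI allI impI exI[of _ x]) simp_all
  then show ?thesis by blast
qed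

end

section \<open>Independent sets of the unit-quadrance graph\<close>

lemma of_nat_CARD_finite_field: "of_nat CARD('a :: finite_field) = (0 :: 'a)"
proof -
  have "(\<Sum>x\<in>UNIV. x :: 'a) = (\<Sum>x\<in>UNIV. x + 1)"
    by (rule sum.reindex_bij_witness[of _ "\<lambda>x. x + 1" "\<lambda>x. x - 1"]) auto
  then show ?thesis by (simp add: sum.distrib)
qed

lemma CHAR_eq_if_CARD_eq_prime_power:
  assumes "CARD('a :: finite_field) = p ^ n" "prime p"
  shows "CHAR('a) = p"
proof -
  have "CHAR('a) dvd p ^ n"
    using of_nat_CARD_finite_field[where 'a = 'a] assms(1) by (metis of_nat_eq_0_iff_char_dvd)
  then have "CHAR('a) dvd p" by (rule prime_dvd_power[OF CHAR_prime])
  then show ?thesis by (rule primes_dvd_imp_eq[OF CHAR_prime assms(2)])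
qed

lemma two_neq_zero_finite_field:
  assumes "odd CARD('a :: finite_field)"
  shows "(2 :: 'a) \<noteq> 0"
proof
  assume two: "(2 :: 'a) = 0"
  obtain m where m: "CARD('a) = 2 * m + 1" using assms by (auto elim: oddE)
  have "of_nat CARD('a) = (2 * of_nat m + 1 :: 'a)" unfolding m by simp
  then show False unfolding of_nat_CARD_finite_field two by simp
qed

lemma sum_UNIV_prod:
  fixes f :: "'a :: finite \<Rightarrow> 'b :: finite \<Rightarrow> 'c :: comm_monoid_add"
  shows "(\<Sum>x\<in>UNIV. \<Sum>y\<in>UNIV. f x y) = (\<Sum>z\<in>UNIV. f (fst z) (snd z))"
  unfolding sum.cartesian_product UNIV_Times_UNIV case_prod_unfold ..

text \<open>Squaring has fibres of at most two elements and the order is odd, so the squares fill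
  more than half of the field. Hence the set \<open>S\<close> of squares and its reflection m - S
  meet.\<close>

lemma exists_sum_two_squares:
  assumes odd: "odd CARD('a :: finite_field)"
  shows "\<exists>x y :: 'a. x\<^sup>2 + y\<^sup>2 = m"
proof -
  define S where "S = range (\<lambda>x :: 'a. x\<^sup>2)"
  have fibre: "card {x :: 'a. x\<^sup>2 = s} \<le> 2" for s
  proof (cases "{x :: 'a. x\<^sup>2 = s} = {}")
    case False
    then obtain x0 where "x0\<^sup>2 = s" by blast
    then have "{x :: 'a. x\<^sup>2 = s} \<subseteq> {x0, - x0}" by (auto simp: power2_eq_iff)
    then have "card {x :: 'a. x\<^sup>2 = s} \<le> card {x0, - x0}" by (rule card_mono[rotated]) simp
    also have "\<dots> \<le> 2" by (simp add: card_insert_if)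
    finally show ?thesis .
  qed simp
  have "CARD('a) = (\<Sum>s\<in>S. card {x :: 'a. x\<^sup>2 = s})"
    using sum.group[of "UNIV :: 'a set" S "\<lambda>x. x\<^sup>2" "\<lambda>_. 1 :: nat"] by (simp add: S_def)
  also have "\<dots> \<le> (\<Sum>s\<in>S. 2)" by (rule sum_mono) (rule fibre)
  finally have "CARD('a) \<le> 2 * card S" by (simp add: mult.commute)
  moreover have "CARD('a) \<noteq> 2 * card S" using odd by presburger
  ultimately have less: "CARD('a) < card S + card ((\<lambda>s. m - s) ` S)"
    by (subst card_image) (auto simp: inj_on_def)
  have "S \<inter> (\<lambda>s. m - s) ` S \<noteq> {}"
  proof
    assume "S \<inter> (\<lambda>s. m - s) ` S = {}"
    then have "card S + card ((\<lambda>s. m - s) ` S) = card (S \<union> (\<lambda>s. m - s) ` S)"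
      by (subst card_Un_disjoint) auto
    also have "\<dots> \<le> CARD('a)" by (rule card_mono) auto
    finally show False using less by simp
  qed
  then obtain x y where "x\<^sup>2 = m - y\<^sup>2" by (auto simp: S_def)
  then have "x\<^sup>2 + y\<^sup>2 = m" by simp
  then show ?thesis by blast
qed

text \<open>The Weil bound is pulled back along the embedding of \<open>'a\<close> into its
  algebraic closure. The image is all of \<open>E\<close>, since it lies in \<open>E\<close> and has
  the same number of elements.\<close>

lemma exists_character_kloosterman_bound:
  assumes card: "CARD('a :: finite_field) = p ^ n" and p: "prime p" "odd p"
  shows "\<exists>\<chi> :: 'a \<Rightarrow> complex. add_character UNIV \<chi> \<and>
    (\<forall>a. a \<noteq> 0 \<longrightarrow> norm (kloosterman UNIV \<chi> a) \<le> 2 * sqrt CARD('a))"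
proof -
  have char: "CHAR('a alg_closure) = p"
    using CHAR_eq_if_CARD_eq_prime_power[OF card p(1)] by simp
  define E where "E = {x :: 'a alg_closure. x ^ CARD('a) = x}"
  have "n \<noteq> 0" using card_mono[of "UNIV :: 'a set" "{0, 1}"] card by (cases n) auto
  then interpret odd_subfield "CARD('a)" n E
    by unfold_locales (use char p card in \<open>auto simp: E_def\<close>)
  have "range (to_ac :: 'a \<Rightarrow> 'a alg_closure) = E"
  proof (rule card_subset_eq)
    show "range to_ac \<subseteq> E"
      by (auto simp: E_def finite_field_power_card_eq_same simp flip: to_ac_power)
    show "card (range (to_ac :: 'a \<Rightarrow> 'a alg_closure)) = card E"
      unfolding card_E by (rule card_image) (rule inj_to_ac)
  qed simp
  then have bij: "bij_betw to_ac (UNIV :: 'a set) E"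
    using inj_to_ac by (simp add: bij_betw_def)
  then have bij0: "bij_betw to_ac (UNIV - {0 :: 'a}) (E - {0})"
    using bij_betw_DiffI[OF bij, of "{0}" "{0}"] by (simp add: bij_betw_def)
  obtain \<psi> where \<psi>: "add_character E \<psi>" using exists_add_character by blast
  define \<chi> where "\<chi> x = \<psi> (to_ac x)" for x :: 'a
  have mem: "to_ac x \<in> E" for x :: 'a using bij by (auto simp: bij_betw_def)
  have "\<exists>x. \<chi> x \<noteq> 1"
    using \<psi> bij unfolding add_character_def bij_betw_def \<chi>_def by blast
  then have "add_character UNIV \<chi>"
    using \<psi> mem by (simp add: add_character_def \<chi>_def)
  moreover have "norm (kloosterman UNIV \<chi> a) \<le> 2 * sqrt CARD('a)" if "a \<noteq> 0" for a
  proof -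
    have "kloosterman UNIV \<chi> a = kloosterman E \<psi> (to_ac a)"
      unfolding kloosterman_def sum.reindex_bij_betw[OF bij0, symmetric] by (simp add: \<chi>_def)
    then show ?thesis using norm_kloosterman_le[OF \<psi> mem, of a] that by simp
  qed
  ultimately show ?thesis by blast
qed

locale kloosterman_character =
  fixes \<chi> :: "'a :: finite_field \<Rightarrow> complex" and q :: nat
  assumes char: "add_character UNIV \<chi>" and q_def: "q = CARD('a)" and odd_q: "odd q"
    and kl: "a \<noteq> 0 \<Longrightarrow> norm (kloosterman UNIV \<chi> a) \<le> 2 * sqrt q"
begin

lemma chi_add: "\<chi> (x + y) = \<chi> x * \<chi> y"
  using add_character_add[OF char] by simp

lemma chi_0: "\<chi> 0 = 1"
  using add_character_zero[OF char] by simp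

lemma chi_minus: "\<chi> (- x) = cnj (\<chi> x)"
  using add_character_minus[OF char] by simp

lemma two_nz: "(2 :: 'a) \<noteq> 0"
  using two_neq_zero_finite_field odd_q by (simp add: q_def)

lemma q_pos: "0 < q" by (simp add: q_def)

lemma sum_scale: "c \<noteq> 0 \<Longrightarrow> (\<Sum>x\<in>UNIV. f (c * x :: 'a)) = (\<Sum>x\<in>UNIV. f x)"
  by (rule sum.reindex_bij_witness[of _ "\<lambda>x. x / c" "\<lambda>x. c * x"]) auto

lemma sum_shift: "(\<Sum>x\<in>UNIV. f (x + c :: 'a)) = (\<Sum>x\<in>UNIV. f x)"
  by (rule sum.reindex_bij_witness[of _ "\<lambda>x. x - c" "\<lambda>x. x + c"]) auto

lemma sum_chi: "(\<Sum>x\<in>UNIV. \<chi> (x * c)) = (if c = 0 then of_nat q else 0)"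
proof (cases "c = 0")
  case True then show ?thesis by (simp add: chi_0 q_def)
next
  case False
  obtain y where y: "\<chi> y \<noteq> 1" using char by (auto simp: add_character_def)
  have "(\<Sum>x\<in>UNIV. \<chi> x) = (\<Sum>x\<in>UNIV. \<chi> (x + y))" by (rule sum_shift[symmetric])
  also have "\<dots> = (\<Sum>x\<in>UNIV. \<chi> x) * \<chi> y" by (simp add: chi_add sum_distrib_right)
  finally have "(\<Sum>x\<in>UNIV. \<chi> x) = 0" using y by simp
  then show ?thesis using sum_scale[OF False, of \<chi>] False by (simp add: mult.commute)
qed

lemma sum_chi2: "(\<Sum>u\<in>UNIV. \<Sum>v\<in>UNIV. \<chi> (u * x + v * y)) = (if x = 0 \<and> y = 0 then of_nat q ^ 2 else 0)"
proof -
  have "(\<Sum>u\<in>UNIV. \<Sum>v\<in>UNIV. \<chi> (u * x + v * y)) = (\<Sum>u\<in>UNIV. \<chi> (u * x)) * (\<Sum>v\<in>UNIV. \<chi> (v * y))"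
    by (simp add: chi_add sum_product)
  then show ?thesis by (simp add: sum_chi power2_eq_square)
qed

section \<open>Quadratic Gauss sums and points on circles\<close>

definition gauss :: "'a \<Rightarrow> complex" where
  "gauss t = (\<Sum>x\<in>UNIV. \<chi> (t * x\<^sup>2))"

text \<open>Shifting x by y turns x^2 - y^2 into x^2 + 2 x y, which is linear in y, so that
  orthogonality leaves only x = 0.\<close>

lemma norm_gauss:
  assumes "t \<noteq> 0"
  shows "(norm (gauss t))\<^sup>2 = q"
proof -
  have "complex_of_real ((norm (gauss t))\<^sup>2) = gauss t * cnj (gauss t)"
    by (rule complex_norm_square)
  also have "\<dots> = (\<Sum>x\<in>UNIV. \<Sum>y\<in>UNIV. \<chi> (t * x\<^sup>2 + - (t * y\<^sup>2)))"
    unfolding gauss_def cnj_sum sum_product chi_minus[symmetric] chi_add[symmetric] ..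
  also have "\<dots> = (\<Sum>x\<in>UNIV. \<Sum>y\<in>UNIV. \<chi> (t * (x + y)\<^sup>2 + - (t * y\<^sup>2)))"
    by (subst (1 2) sum.swap) (simp only: sum_shift[of "\<lambda>x. \<chi> (t * x\<^sup>2 + - (t * y\<^sup>2))" y for y])
  also have "\<dots> = (\<Sum>x\<in>UNIV. \<chi> (t * x\<^sup>2) * (\<Sum>y\<in>UNIV. \<chi> (y * (2 * t * x))))"
    by (simp add: sum_distrib_left chi_add[symmetric] algebra_simps power2_eq_square)
  also have "\<dots> = (\<Sum>x\<in>(UNIV :: 'a set). if x = 0 then of_nat q else 0)"
  proof (intro sum.cong refl)
    fix x :: 'a
    show "\<chi> (t * x\<^sup>2) * (\<Sum>y\<in>UNIV. \<chi> (y * (2 * t * x))) = (if x = 0 then of_nat q else 0)"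
      unfolding sum_chi using assms two_nz by (cases "x = 0") (simp_all add: chi_0)
  qed
  also have "\<dots> = of_nat q" by simp
  finally show ?thesis using of_real_eq_iff by (metis of_real_of_nat_eq)
qed

definition sphere :: "'a \<Rightarrow> ('a \<times> 'a) set" where
  "sphere m = {(x, y). x\<^sup>2 + y\<^sup>2 = m}"

text \<open>Multiplication by a + b i, where a^2 + b^2 = m, carries the unit circle to the circle of
  quadrance m, and division by it carries it back.\<close>

lemma card_sphere_eq:
  assumes "m \<noteq> 0"
  shows "card (sphere m) = card (sphere 1)"
proof -
  obtain a b where ab: "a\<^sup>2 + b\<^sup>2 = m"
    using exists_sum_two_squares[of m] odd_q unfolding q_def by blast
  have "bij_betw (\<lambda>(x, y). (a * x - b * y, b * x + a * y)) (sphere 1) (sphere m)"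
  proof (rule bij_betw_byWitness[where f' = "\<lambda>(x, y). ((a * x + b * y) / m, (a * y - b * x) / m)"])
    have 1: "a * (a * x - b * y) + b * (b * x + a * y) = m * x" for x y
      unfolding ab[symmetric] by (simp add: algebra_simps power2_eq_square)
    have 2: "a * (b * x + a * y) - b * (a * x - b * y) = m * y" for x y
      unfolding ab[symmetric] by (simp add: algebra_simps power2_eq_square)
    have 3: "a * (a * x + b * y) - b * (a * y - b * x) = m * x" for x y
      unfolding ab[symmetric] by (simp add: algebra_simps power2_eq_square)
    have 4: "b * (a * x + b * y) + a * (a * y - b * x) = m * y" for x y
      unfolding ab[symmetric] by (simp add: algebra_simps power2_eq_square)
    have 5: "(a * x - b * y)\<^sup>2 + (b * x + a * y)\<^sup>2 = m * (x\<^sup>2 + y\<^sup>2)" for x y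
      unfolding ab[symmetric] by (simp add: algebra_simps power2_eq_square)
    have 6: "(a * x + b * y)\<^sup>2 + (a * y - b * x)\<^sup>2 = m * (x\<^sup>2 + y\<^sup>2)" for x y
      unfolding ab[symmetric] by (simp add: algebra_simps power2_eq_square)
    show "\<forall>z\<in>sphere 1. (case case z of (x, y) \<Rightarrow> (a * x - b * y, b * x + a * y) of
        (x, y) \<Rightarrow> ((a * x + b * y) / m, (a * y - b * x) / m)) = z"
      using assms by (auto simp: 1 2)
    show "\<forall>z\<in>sphere m. (case case z of (x, y) \<Rightarrow> ((a * x + b * y) / m, (a * y - b * x) / m) of
        (x, y) \<Rightarrow> (a * x - b * y, b * x + a * y)) = z"
      using assms by (auto simp: 3 4 simp flip: add_divide_distrib diff_divide_distrib)
    show "(\<lambda>(x, y). (a * x - b * y, b * x + a * y)) ` sphere 1 \<subseteq> sphere m"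
      by (auto simp: sphere_def 5)
    have "((a * x + b * y) / m)\<^sup>2 + ((a * y - b * x) / m)\<^sup>2 = 1" if "x\<^sup>2 + y\<^sup>2 = m" for x y
    proof -
      have "((a * x + b * y) / m)\<^sup>2 + ((a * y - b * x) / m)\<^sup>2 = (m * (x\<^sup>2 + y\<^sup>2)) / m\<^sup>2"
        by (simp only: power_divide add_divide_distrib[symmetric] 6)
      then show ?thesis using assms that by (simp add: power2_eq_square)
    qed
    then show "(\<lambda>(x, y). ((a * x + b * y) / m, (a * y - b * x) / m)) ` sphere m \<subseteq> sphere 1"
      by (auto simp: sphere_def)
  qed
  then show ?thesis by (rule bij_betw_same_card[symmetric])
qed

text \<open>All circles of nonzero quadrance have the same size, which splits the sum into a
  complete sum over m and a correction at m = 0. For a nontrivial character only the correction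
  survives.\<close>

lemma sum_sphere:
  fixes f :: "'a \<Rightarrow> complex"
  shows "(\<Sum>x\<in>UNIV. \<Sum>y\<in>UNIV. f (x\<^sup>2 + y\<^sup>2))
    = of_nat (card (sphere 0)) * f 0 - of_nat (card (sphere 1)) * f 0 + of_nat (card (sphere 1)) * (\<Sum>m\<in>UNIV. f m)"
proof -
  have "(\<Sum>x\<in>UNIV. \<Sum>y\<in>UNIV. f (x\<^sup>2 + y\<^sup>2)) = (\<Sum>z\<in>UNIV. f ((fst z)\<^sup>2 + (snd z)\<^sup>2))"
    by (rule sum_UNIV_prod)
  also have "\<dots> = (\<Sum>m\<in>UNIV. \<Sum>z | z \<in> UNIV \<and> (fst z)\<^sup>2 + (snd z)\<^sup>2 = m. f ((fst z)\<^sup>2 + (snd z)\<^sup>2))"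
    by (rule sum.group[symmetric]) auto
  also have "\<dots> = (\<Sum>m\<in>UNIV. of_nat (card (sphere m)) * f m)"
  proof (rule sum.cong[OF refl])
    fix m
    have set: "{z. z \<in> UNIV \<and> (fst z)\<^sup>2 + (snd z)\<^sup>2 = m} = sphere m" by (auto simp: sphere_def)
    have "(\<Sum>z\<in>sphere m. f ((fst z)\<^sup>2 + (snd z)\<^sup>2)) = (\<Sum>z\<in>sphere m. f m)"
      by (rule sum.cong) (auto simp: sphere_def)
    then show "(\<Sum>z | z \<in> UNIV \<and> (fst z)\<^sup>2 + (snd z)\<^sup>2 = m. f ((fst z)\<^sup>2 + (snd z)\<^sup>2))
        = of_nat (card (sphere m)) * f m"
      unfolding set by simp
  qed
  also have "\<dots> = of_nat (card (sphere 0)) * f 0 + (\<Sum>m\<in>UNIV - {0}. of_nat (card (sphere m)) * f m)"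
    by (rule sum.remove) auto
  also have "(\<Sum>m\<in>UNIV - {0}. of_nat (card (sphere m)) * f m)
      = (\<Sum>m\<in>UNIV - {0}. of_nat (card (sphere 1)) * f m)"
  proof (rule sum.cong[OF refl])
    fix m :: 'a assume "m \<in> UNIV - {0}"
    then have "card (sphere m) = card (sphere 1)" by (intro card_sphere_eq) simp
    then show "of_nat (card (sphere m)) * f m = of_nat (card (sphere 1)) * f m" by (simp only:)
  qed
  also have "\<dots> = of_nat (card (sphere 1)) * (\<Sum>m\<in>UNIV - {0}. f m)"
    by (rule sum_distrib_left[symmetric])
  also have "(\<Sum>m\<in>UNIV - {0}. f m) = (\<Sum>m\<in>UNIV. f m) - f 0"
    using sum.remove[of UNIV 0 f] by simp
  finally show ?thesis by (simp add: algebra_simps)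
qed

text \<open>The common value of \<open>(gauss t)\<^sup>2\<close> for all nonzero t, classically q or
  -q. Written with point counts, its independence of t is evident.\<close>

definition gauss_square :: complex where
  "gauss_square = of_nat (card (sphere 0)) - of_nat (card (sphere 1))"

lemma gauss_square:
  assumes "t \<noteq> 0"
  shows "(gauss t)\<^sup>2 = gauss_square"
proof -
  have "(gauss t)\<^sup>2 = (\<Sum>x\<in>UNIV. \<Sum>y\<in>UNIV. \<chi> ((x\<^sup>2 + y\<^sup>2) * t))"
    by (simp add: gauss_def power2_eq_square sum_product chi_add[symmetric] algebra_simps)
  also have "\<dots> = gauss_square"
    unfolding sum_sphere[of "\<lambda>m. \<chi> (m * t)"] using assms by (simp add: sum_chi chi_0 gauss_square_def)
  finally show ?thesis .
qed

lemma norm_gauss_square: "norm gauss_square = q"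
  using norm_gauss[of 1] gauss_square[of 1] by (metis norm_power zero_neq_one)

text \<open>This is the degree of the graph. Counting all q^2 points by quadrance shows that q times
  (q - degree) equals \<open>gauss_square\<close>, of modulus q, so the degree differs from q by
  exactly 1.\<close>

lemma card_sphere_ge: "real q - 1 \<le> card (sphere 1)"
proof -
  have "(of_nat q)\<^sup>2 = gauss_square + of_nat (card (sphere 1)) * of_nat q"
    using sum_sphere[of "\<lambda>_. 1"] by (simp add: gauss_square_def q_def power2_eq_square)
  then have "complex_of_nat q * (of_nat q - of_nat (card (sphere 1))) = gauss_square"
    by (simp add: algebra_simps power2_eq_square)
  then have *: "complex_of_real (real q * (real q - real (card (sphere 1)))) = gauss_square"
    by simp
  have "\<bar>real q * (real q - real (card (sphere 1)))\<bar> = real q"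
    using norm_gauss_square unfolding *[symmetric] norm_of_real .
  then have "real q * \<bar>real q - real (card (sphere 1))\<bar> = real q * 1"
    by (simp only: abs_mult abs_of_nat mult_1_right)
  then have "\<bar>real q - real (card (sphere 1))\<bar> = 1" using q_pos by simp
  then show ?thesis by linarith
qed

text \<open>These sums are the nontrivial eigenvalues. The circle equation is detected by characters
  with parameter t; for nonzero t, completing squares gives \<open>(gauss t)\<^sup>2\<close>, the
  same for all t, times a phase whose sum over t is a Kloosterman sum. The term t = 0 vanishes
  because (u, v) is nonzero.\<close>

lemma norm_sphere_sum:
  assumes "u \<noteq> 0 \<or> v \<noteq> 0"
  shows "norm (\<Sum>(x, y)\<in>sphere 1. \<chi> (u * x + v * y)) \<le> 2 * sqrt q"
proof -
  define N where "N = (u\<^sup>2 + v\<^sup>2) / 4"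
  have four: "(4 :: 'a) \<noteq> 0" using two_nz mult_eq_0_iff[of "2 :: 'a" 2] by simp
  define L where "L = (\<Sum>(x, y)\<in>sphere 1. \<chi> (u * x + v * y))"
  define T where "T t = (\<Sum>x\<in>UNIV. \<Sum>y\<in>UNIV. \<chi> (t * (x\<^sup>2 + y\<^sup>2 - 1) + (u * x + v * y)))" for t
  have "(\<Sum>t\<in>UNIV. T t) = (\<Sum>x\<in>UNIV. \<Sum>y\<in>UNIV. \<Sum>t\<in>UNIV. \<chi> (t * (x\<^sup>2 + y\<^sup>2 - 1) + (u * x + v * y)))"
    unfolding T_def by (subst sum.swap, rule sum.cong[OF refl], rule sum.swap)
  also have "\<dots> = (\<Sum>x\<in>UNIV. \<Sum>y\<in>UNIV. if x\<^sup>2 + y\<^sup>2 = 1 then of_nat q * \<chi> (u * x + v * y) else 0)"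
    by (intro sum.cong refl) (simp add: chi_add sum_distrib_right[symmetric] sum_chi)
  also have "\<dots> = (\<Sum>z\<in>UNIV. if (fst z)\<^sup>2 + (snd z)\<^sup>2 = 1 then of_nat q * \<chi> (u * fst z + v * snd z) else 0)"
    by (rule sum_UNIV_prod)
  also have "\<dots> = (\<Sum>z\<in>sphere 1. of_nat q * \<chi> (u * fst z + v * snd z))"
    by (rule sum.mono_neutral_cong_right) (auto simp: sphere_def)
  also have "\<dots> = of_nat q * L" by (simp add: L_def sum_distrib_left case_prod_unfold)
  finally have sumT: "(\<Sum>t\<in>UNIV. T t) = of_nat q * L" .
  have T0: "T 0 = 0"
    using sum_chi2[of u v] assms by (auto simp: T_def mult.commute)
  have Tt: "T t = gauss_square * \<chi> (- t + - N / t)" if t: "t \<noteq> 0" for t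
  proof -
    define c d where "c = u / (2 * t)" and "d = v / (2 * t)"
    have cd: "2 * t * c = u" "2 * t * d = v" using t two_nz by (simp_all add: c_def d_def)
    have "t * c\<^sup>2 + t * d\<^sup>2 = N / t"
      using t four by (simp add: c_def d_def N_def power2_eq_square field_simps)
    then have *: "t * (x\<^sup>2 + y\<^sup>2 - 1) + (u * x + v * y) = t * (x + c)\<^sup>2 + t * (y + d)\<^sup>2 + (- t + - N / t)" for x y
      unfolding cd[symmetric] by (simp add: algebra_simps power2_eq_square)
    have "T t = (\<Sum>x\<in>UNIV. \<chi> (t * (x + c)\<^sup>2)) * (\<Sum>y\<in>UNIV. \<chi> (t * (y + d)\<^sup>2)) * \<chi> (- t + - N / t)"
      unfolding T_def * chi_add sum_product sum_distrib_right[symmetric] ..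
    also have "\<dots> = (gauss t)\<^sup>2 * \<chi> (- t + - N / t)"
      using sum_shift[of "\<lambda>x. \<chi> (t * x\<^sup>2)"] by (simp add: gauss_def power2_eq_square)
    finally show ?thesis by (simp only: gauss_square[OF t])
  qed
  have "(\<Sum>t\<in>UNIV. T t) = (\<Sum>t\<in>UNIV - {0}. T t)"
    using sum.remove[of UNIV 0 T] T0 by simp
  also have "\<dots> = gauss_square * (\<Sum>t\<in>UNIV - {0}. \<chi> (- t + - N / t))"
    unfolding sum_distrib_left by (rule sum.cong) (auto simp: Tt)
  also have "(\<Sum>t\<in>UNIV - {0}. \<chi> (- t + - N / t)) = kloosterman UNIV \<chi> N"
    unfolding kloosterman_def
    by (rule sum.reindex_bij_witness[of _ uminus uminus]) auto
  finally have "of_nat q * L = gauss_square * kloosterman UNIV \<chi> N" using sumT by simp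
  then have "real q * norm L = real q * norm (kloosterman UNIV \<chi> N)"
    using norm_gauss_square by (metis norm_mult norm_of_nat)
  then have eq: "norm L = norm (kloosterman UNIV \<chi> N)" using q_pos by simp
  show ?thesis
  proof (cases "N = 0")
    case False
    then show ?thesis using kl eq unfolding L_def by simp
  next
    \<comment> \<open>At isotropic frequencies, u^2 + v^2 = 0, the Kloosterman sum degenerates to a
      character sum over the nonzero elements, which is -1.\<close>
    case True
    have "kloosterman UNIV \<chi> 0 = (\<Sum>x\<in>UNIV. \<chi> (x * 1)) - \<chi> 0"
      using sum.remove[of UNIV 0 \<chi>] by (simp add: kloosterman_def)
    then have "kloosterman UNIV \<chi> 0 = - 1" unfolding sum_chi by (simp add: chi_0)
    then have "norm L = 1" using eq True by simp
    moreover have "1 \<le> sqrt q" using q_pos by simp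
    ultimately have "norm L \<le> 2 * sqrt q" by linarith
    then show ?thesis unfolding L_def .
  qed
qed

text \<open>Orthogonality over the plane. It serves twice: with \<open>C\<close> the unit circle it
  counts adjacent pairs in \<open>A\<close>, and with \<open>C\<close> the origin it is Parseval's
  identity.\<close>

lemma fourier_count:
  fixes C A :: "('a \<times> 'a) set"
  defines "F \<equiv> (\<lambda>B u v. \<Sum>z\<in>B. \<chi> (u * fst z + v * snd z))"
  shows "(\<Sum>u\<in>UNIV. \<Sum>v\<in>UNIV. F C u v * (F A u v * cnj (F A u v)))
    = of_nat q ^ 2 * of_nat (card {(c, a, b) \<in> C \<times> A \<times> A. fst c + fst a = fst b \<and> snd c + snd a = snd b})"
proof -
  have "F C u v * (F A u v * cnj (F A u v)) = (\<Sum>w\<in>C \<times> A \<times> A.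
      \<chi> (u * (fst (fst w) + fst (fst (snd w)) - fst (snd (snd w)))
        + v * (snd (fst w) + snd (fst (snd w)) - snd (snd (snd w)))))" for u v
  proof -
    have product: "sum f C * (sum g A * sum h A) = (\<Sum>c\<in>C. \<Sum>a\<in>A. \<Sum>b\<in>A. f c * (g a * h b))"
      for f g h :: "'a \<times> 'a \<Rightarrow> complex"
      by (simp only: sum_distrib_left[symmetric] sum_distrib_right[symmetric])
    have "F C u v * (F A u v * cnj (F A u v)) = (\<Sum>c\<in>C. \<Sum>a\<in>A. \<Sum>b\<in>A.
        \<chi> (u * fst c + v * snd c) * (\<chi> (u * fst a + v * snd a) * \<chi> (- (u * fst b + v * snd b))))"
      unfolding F_def cnj_sum chi_minus by (rule product)
    also have "\<dots> = (\<Sum>c\<in>C. \<Sum>a\<in>A. \<Sum>b\<in>A.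
        \<chi> (u * (fst c + fst a - fst b) + v * (snd c + snd a - snd b)))"
      unfolding chi_add[symmetric] by (simp add: algebra_simps)
    finally show ?thesis by (simp add: sum.cartesian_product case_prod_unfold)
  qed
  then have "(\<Sum>u\<in>UNIV. \<Sum>v\<in>UNIV. F C u v * (F A u v * cnj (F A u v))) = (\<Sum>w\<in>C \<times> A \<times> A. \<Sum>u\<in>UNIV. \<Sum>v\<in>UNIV.
      \<chi> (u * (fst (fst w) + fst (fst (snd w)) - fst (snd (snd w)))
        + v * (snd (fst w) + snd (fst (snd w)) - snd (snd (snd w)))))"
    by (simp only: sum.swap[of _ UNIV "C \<times> A \<times> A"])
  also have "\<dots> = (\<Sum>w\<in>C \<times> A \<times> A. if fst (fst w) + fst (fst (snd w)) = fst (snd (snd w))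
      \<and> snd (fst w) + snd (fst (snd w)) = snd (snd (snd w)) then of_nat q ^ 2 else 0)"
    unfolding sum_chi2 by simp
  also have "\<dots> = (\<Sum>w\<in>{w \<in> C \<times> A \<times> A. fst (fst w) + fst (fst (snd w)) = fst (snd (snd w))
      \<and> snd (fst w) + snd (fst (snd w)) = snd (snd (snd w))}. of_nat q ^ 2)"
    by (rule sum.inter_filter[symmetric]) simp
  also have "{w \<in> C \<times> A \<times> A. fst (fst w) + fst (fst (snd w)) = fst (snd (snd w))
      \<and> snd (fst w) + snd (fst (snd w)) = snd (snd (snd w))}
      = {(c, a, b) \<in> C \<times> A \<times> A. fst c + fst a = fst b \<and> snd c + snd a = snd b}" by auto
  finally show ?thesis by (simp add: mult.commute)
qed

text \<open>Hoffman's ratio bound in Fourier form. Without adjacent pairs the weighted sum over all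
  frequencies is 0, so the term at frequency 0, the degree times |A|^2, is balanced by the others;
  by Parseval those amount to at most 2 sqrt q times q^2 |A| - |A|^2.\<close>

lemma card_independent_le:
  fixes A :: "('a \<times> 'a) set"
  assumes indep: "\<And>a b. a \<in> A \<Longrightarrow> b \<in> A \<Longrightarrow> (fst b - fst a)\<^sup>2 + (snd b - snd a)\<^sup>2 \<noteq> 1"
  shows "real (card A) * (real q - 1 + 2 * sqrt q) \<le> 2 * sqrt q * (real q)\<^sup>2"
proof (cases "A = {}")
  case False
  define F where "F = (\<lambda>B u v. \<Sum>z\<in>B. \<chi> (u * fst z + v * snd z))"
  define g where "g = (\<lambda>z. (norm (F A (fst z) (snd z)))\<^sup>2)"
  define L where "L = (\<lambda>z. F (sphere 1) (fst z) (snd z))"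
  have FA: "F A u v * cnj (F A u v) = of_real (g (u, v))" for u v
    by (simp only: g_def complex_norm_square fst_conv snd_conv)
  have "{(c, a, b) \<in> sphere 1 \<times> A \<times> A. fst c + fst a = fst b \<and> snd c + snd a = snd b} = {}"
  proof -
    have False if "c \<in> sphere 1" "a \<in> A" "b \<in> A" "fst c + fst a = fst b" "snd c + snd a = snd b" for c a b
    proof -
      have "fst c = fst b - fst a" "snd c = snd b - snd a" using that by (simp_all add: eq_diff_eq)
      then show False using that(1) indep[OF that(2,3)] by (auto simp: sphere_def)
    qed
    then show ?thesis by blast
  qed
  then have "(\<Sum>u\<in>UNIV. \<Sum>v\<in>UNIV. F (sphere 1) u v * (F A u v * cnj (F A u v))) = 0"
    using fourier_count[of "sphere 1" A] by (simp add: F_def)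
  then have "(\<Sum>z\<in>UNIV. L z * of_real (g z)) = 0"
    unfolding FA sum_UNIV_prod by (simp add: L_def)
  then have 1: "L (0, 0) * of_real (g (0, 0)) = - (\<Sum>z\<in>UNIV - {(0, 0)}. L z * of_real (g z))"
    using sum.remove[of UNIV "(0, 0)" "\<lambda>z. L z * of_real (g z)"] by (simp add: eq_neg_iff_add_eq_0)
  have "{(c, a, b) \<in> {(0, 0)} \<times> A \<times> A. fst c + fst a = fst b \<and> snd c + snd a = snd b}
      = (\<lambda>a. ((0, 0), a, a)) ` A" by (auto simp: prod_eq_iff)
  then have "card {(c, a, b) \<in> {(0, 0)} \<times> A \<times> A. fst c + fst a = fst b \<and> snd c + snd a = snd b} = card A"
    by (simp add: card_image inj_on_def)
  then have "(\<Sum>u\<in>UNIV. \<Sum>v\<in>UNIV. F A u v * cnj (F A u v)) = of_nat q ^ 2 * of_nat (card A)"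
    using fourier_count[of "{(0, 0)}" A] by (simp add: F_def chi_0)
  then have "of_real (\<Sum>z\<in>UNIV. g z) = complex_of_real (real q ^ 2 * real (card A))"
    unfolding FA sum_UNIV_prod by simp
  then have "(\<Sum>z\<in>UNIV. g z) = real q ^ 2 * real (card A)" by (simp only: of_real_eq_iff)
  then have 2: "(\<Sum>z\<in>UNIV - {(0, 0)}. g z) = real q ^ 2 * real (card A) - g (0, 0)"
    using sum.remove[of UNIV "(0, 0)" g] by simp
  have g0: "g (0, 0) = (real (card A))\<^sup>2" by (simp add: g_def F_def chi_0)
  have L0: "L (0, 0) = of_nat (card (sphere 1))" by (simp add: L_def F_def chi_0)
  have "real (card (sphere 1)) * (real (card A))\<^sup>2 = norm (L (0, 0) * of_real (g (0, 0)))"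
    by (simp only: g0 L0 norm_mult norm_of_nat norm_of_real) simp
  also have "\<dots> \<le> (\<Sum>z\<in>UNIV - {(0, 0)}. norm (L z * of_real (g z)))"
    unfolding 1 norm_minus_cancel by (rule norm_sum)
  also have "\<dots> \<le> (\<Sum>z\<in>UNIV - {(0, 0)}. 2 * sqrt q * g z)"
  proof (rule sum_mono)
    fix z assume "z \<in> UNIV - {(0 :: 'a, 0 :: 'a)}"
    then have "fst z \<noteq> 0 \<or> snd z \<noteq> 0" by (auto simp: prod_eq_iff)
    then have "norm (L z) \<le> 2 * sqrt q"
      using norm_sphere_sum by (simp add: L_def F_def case_prod_unfold)
    moreover have g: "0 \<le> g z" by (simp add: g_def)
    ultimately show "norm (L z * of_real (g z)) \<le> 2 * sqrt q * g z"
      unfolding norm_mult norm_of_real abs_of_nonneg[OF g] by (intro mult_right_mono)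
  qed
  also have "\<dots> = 2 * sqrt q * (real q ^ 2 * real (card A) - (real (card A))\<^sup>2)"
    by (simp only: sum_distrib_left[symmetric] 2 g0)
  finally have "real (card A) * (real (card A) * (real (card (sphere 1)) + 2 * sqrt q))
      \<le> real (card A) * (2 * sqrt q * (real q)\<^sup>2)"
    by (simp add: algebra_simps power2_eq_square)
  moreover have "0 < card A" using False by (simp add: card_gt_0_iff)
  ultimately have "real (card A) * (real (card (sphere 1)) + 2 * sqrt q) \<le> 2 * sqrt q * (real q)\<^sup>2"
    by simp
  moreover have "real (card A) * (real q - 1 + 2 * sqrt q) \<le> real (card A) * (real (card (sphere 1)) + 2 * sqrt q)"
    using card_sphere_ge by (intro mult_left_mono) auto
  ultimately show ?thesis by linarith
qed simp

end

section \<open>A colouring by pairs of parallel lines\<close>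

text \<open>If \<open>N - \<delta>\<^sup>2\<close> were a square for all nonzero \<open>\<delta>\<close>, then \<open>s \<mapsto> N - s\<close> would permute the nonzero
  squares, and comparing their sum (which is zero) with its image would give \<open>(q - 1) N / 2 = 0\<close>.\<close>

lemma exists_nonsquare_diff:
  assumes odd: "odd CARD('a :: finite_field)" and gt3: "3 < CARD('a)"
    and N: "\<And>x :: 'a. x\<^sup>2 \<noteq> N"
  shows "\<exists>\<delta> :: 'a. \<delta> \<noteq> 0 \<and> (\<forall>x. x\<^sup>2 \<noteq> N - \<delta>\<^sup>2)"
proof (rule ccontr)
  assume neg: "\<not> ?thesis"
  note two = two_neq_zero_finite_field[OF odd]
  define S where "S = (\<lambda>x :: 'a. x\<^sup>2) ` (UNIV - {0})"
  have inj: "inj_on (\<lambda>s. N - s) S" by (auto simp: inj_on_def)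
  have sub: "(\<lambda>s. N - s) ` S \<subseteq> S"
  proof (rule image_subsetI)
    fix s assume "s \<in> S"
    then obtain \<delta> where \<delta>: "s = \<delta>\<^sup>2" "\<delta> \<noteq> 0" by (auto simp: S_def)
    then obtain x where "x\<^sup>2 = N - \<delta>\<^sup>2" using neg by blast
    moreover have "x \<noteq> 0" using \<open>x\<^sup>2 = N - \<delta>\<^sup>2\<close> N[of \<delta>] by auto
    ultimately show "N - s \<in> S" unfolding S_def \<delta>(1) by (intro image_eqI[of _ _ x]) auto
  qed
  then have perm: "bij_betw (\<lambda>s. N - s) S S"
    using inj endo_inj_surj[OF _ sub inj] by (simp add: bij_betw_def)
  \<comment> \<open>Here q > 3 enters. Scaling by c^2 permutes \<open>S\<close>, and c^2 different
    from 1 then forces the sum of \<open>S\<close> to be 0.\<close>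
  have "\<exists>c. c \<notin> {0, 1, - 1 :: 'a}"
  proof (rule ccontr)
    assume "\<not> ?thesis"
    then have "UNIV = {0, 1, - 1 :: 'a}" by blast
    then have "CARD('a) = card {0, 1, - 1 :: 'a}" by simp
    also have "\<dots> \<le> 3" by (simp add: card_insert_if)
    finally show False using gt3 by simp
  qed
  then obtain c where c: "c \<noteq> 0" "c\<^sup>2 \<noteq> (1 :: 'a)" by (auto simp: power2_eq_1_iff)
  have "(\<Sum>s\<in>S. s) = (\<Sum>s\<in>S. c\<^sup>2 * s)"
    by (rule sum.reindex_bij_witness[of _ "\<lambda>s. c\<^sup>2 * s" "\<lambda>s. s / c\<^sup>2"])
      (use c in \<open>auto simp: S_def simp flip: power_mult_distrib power_divide\<close>)
  also have "\<dots> = c\<^sup>2 * (\<Sum>s\<in>S. s)" by (rule sum_distrib_left[symmetric])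
  finally have "(c\<^sup>2 - 1) * (\<Sum>s\<in>S. s) = 0" by (simp add: algebra_simps)
  then have sum0: "(\<Sum>s\<in>S. s) = 0" using c by simp
  have "(\<Sum>s\<in>S. N - s) = (\<Sum>s\<in>S. s)" by (rule sum.reindex_bij_betw[OF perm])
  then have "of_nat (card S) * N = 0" using sum0 by (simp add: sum_subtractf)
  moreover have "N \<noteq> 0" using N[of 0] by auto
  ultimately have cS: "of_nat (card S) = (0 :: 'a)" by simp
  have "card (UNIV - {0 :: 'a}) = (\<Sum>s\<in>S. card {x. x \<in> UNIV - {0} \<and> x\<^sup>2 = s})"
    using sum.group[of "UNIV - {0 :: 'a}" S "\<lambda>x. x\<^sup>2" "\<lambda>_. 1 :: nat"] by (simp add: S_def)
  also have "\<dots> = (\<Sum>s\<in>S. 2)"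
  proof (rule sum.cong[OF refl])
    fix s assume "s \<in> S"
    then obtain y where y: "s = y\<^sup>2" "y \<noteq> 0" by (auto simp: S_def)
    then have "{x. x \<in> UNIV - {0} \<and> x\<^sup>2 = s} = {y, - y}" by (auto simp: power2_eq_iff)
    moreover have "y \<noteq> - y" using two y by (simp add: eq_neg_iff_add_eq_0 flip: mult_2)
    ultimately show "card {x. x \<in> UNIV - {0} \<and> x\<^sup>2 = s} = 2" by simp
  qed
  finally have "CARD('a) = 2 * card S + 1" using gt3 by (simp add: card_Diff_singleton)
  then have "of_nat CARD('a) = (2 * of_nat (card S) + 1 :: 'a)" by simp
  then show False unfolding of_nat_CARD_finite_field cS by simp
qed

lemma exists_nonsquare:
  assumes odd: "odd CARD('a :: finite_field)"
  shows "\<exists>N :: 'a. \<forall>x. x\<^sup>2 \<noteq> N"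
proof (rule ccontr)
  assume "\<not> ?thesis"
  then have "surj (\<lambda>x :: 'a. x\<^sup>2)" by (auto simp: surj_def) metis
  then have "inj (\<lambda>x :: 'a. x\<^sup>2)" by (rule finite_UNIV_surj_inj[OF finite])
  then have "(1 :: 'a) = - 1" by (auto dest: injD[of _ 1 "- 1"])
  then show False using two_neq_zero_finite_field[OF odd] by (simp add: eq_neg_iff_add_eq_0)
qed

text \<open>The cycles are the cosets of the prime field \<open>P\<close>, with the step normalised
  to 1. A coset consists of a representative plus i with i < p, and i div 2 is the colour within it.
  As p is odd, i = p - 1 gets a colour of its own, whence \<open>(p + 1) div 2\<close>; the factor
  \<open>p ^ (n - 1)\<close> counts the cosets.\<close>

lemma exists_coset_colouring:
  assumes card: "CARD('a :: finite_field) = p ^ n" and p: "prime p" "odd p" and n: "0 < n"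
  shows "\<exists>c :: 'a \<Rightarrow> nat. (\<forall>x. c x < p ^ (n - 1) * ((p + 1) div 2))
    \<and> (\<forall>x y. c x = c y \<longrightarrow> x - y \<in> {0, 1, - 1})"
proof -
  have char: "CHAR('a) = p" by (rule CHAR_eq_if_CARD_eq_prime_power[OF card p(1)])
  have p0: "0 < p" using p(1) prime_gt_0_nat by blast
  define P where "P = range (of_nat :: nat \<Rightarrow> 'a)"
  have P_eq: "P = of_nat ` {..<p}"
  proof -
    have "of_nat i = (of_nat (i mod p) :: 'a)" for i
    proof -
      have "of_nat i = (of_nat (p * (i div p) + i mod p) :: 'a)" by simp
      also have "\<dots> = of_nat p * of_nat (i div p) + of_nat (i mod p)"
        by (simp only: of_nat_add of_nat_mult)
      also have "(of_nat p :: 'a) = 0" unfolding char[symmetric] by simp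
      finally show ?thesis by simp
    qed
    then show ?thesis unfolding P_def using p0 by (auto simp: image_iff intro!: bexI[of _ "_ mod p"])
  qed
  have card_P: "card P = p"
    unfolding P_eq using inj_on_of_nat_CHAR[where 'a = 'a] by (simp add: char card_image)
  have P_add: "x + y \<in> P" if "x \<in> P" "y \<in> P" for x y
    using that by (auto simp: P_def simp flip: of_nat_add)
  have P_minus: "- x \<in> P" if x: "x \<in> P" for x
  proof -
    obtain i where i: "x = of_nat i" using x by (auto simp: P_def)
    have "of_nat (i * (p - 1)) = of_nat i * (of_nat p - 1 :: 'a)"
      using p0 by (simp add: of_nat_diff Suc_leI)
    then have "- x = of_nat (i * (p - 1))" by (simp add: i char[symmetric])
    then show ?thesis unfolding P_def by (rule range_eqI)
  qed
  define coset where "coset x = {y. y - x \<in> P}" for x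
  have coset_self: "x \<in> coset x" for x by (auto simp: coset_def P_def intro: range_eqI[of _ _ 0])
  have coset_eq: "coset x = coset y" if "y \<in> coset x" for x y
  proof -
    have yx: "y - x \<in> P" using that by (simp add: coset_def)
    have "z - x \<in> P \<longleftrightarrow> z - y \<in> P" for z
    proof
      show "z - y \<in> P" if "z - x \<in> P" using P_add[OF that P_minus[OF yx]] by simp
      show "z - x \<in> P" if "z - y \<in> P" using P_add[OF that yx] by simp
    qed
    then show ?thesis by (simp add: coset_def)
  qed
  define R where "R = range coset"
  have "CARD('a) = (\<Sum>K\<in>R. card {x. coset x = K})"
    using sum.group[of "UNIV :: 'a set" R coset "\<lambda>_. 1 :: nat"] by (simp add: R_def)
  also have "\<dots> = (\<Sum>K\<in>R. p)"
  proof (rule sum.cong[OF refl])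
    fix K assume "K \<in> R"
    then obtain x where x: "K = coset x" by (auto simp: R_def)
    have "{y. coset y = K} = coset x"
      unfolding x using coset_self coset_eq by blast
    also have "\<dots> = (\<lambda>z. z + x) ` P"
      by (auto simp: coset_def image_iff intro!: bexI[of _ "_ - x"])
    finally have "card {y. coset y = K} = card ((\<lambda>z. z + x) ` P)" by simp
    then show "card {y. coset y = K} = p"
      by (simp add: card_image inj_on_def card_P)
  qed
  finally have "p * p ^ (n - 1) = p * card R"
    using card n by (simp add: mult.commute flip: power_Suc)
  then have card_R: "card R = p ^ (n - 1)" using p0 by simp
  have "finite R" by (simp add: R_def)
  then obtain g where g: "bij_betw g R {0..<card R}" using ex_bij_betw_finite_nat by blast
  define rep where "rep K = (SOME y. y \<in> K)" for K :: "'a set"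
  have rep: "x - rep (coset x) \<in> P" for x
  proof -
    have "rep (coset x) \<in> coset x" unfolding rep_def by (rule someI[of "\<lambda>y. y \<in> coset x", OF coset_self])
    then have "- (rep (coset x) - x) \<in> P" by (intro P_minus) (simp add: coset_def)
    then show ?thesis by simp
  qed
  then have "\<exists>i. i < p \<and> x - rep (coset x) = of_nat i" for x
    unfolding P_eq by (metis imageE lessThan_iff)
  then obtain idx where idx: "\<And>x. idx x < p" "\<And>x. x - rep (coset x) = of_nat (idx x)" by metis
  define m where "m = (p + 1) div 2"
  have m: "i div 2 < m" if "i < p" for i using that p(2) unfolding m_def by presburger
  define c where "c x = g (coset x) * m + idx x div 2" for x
  have c_less: "c x < p ^ (n - 1) * m" for x
  proof -
    have "g (coset x) < p ^ (n - 1)"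
      using bij_betwE[OF g, rule_format, of "coset x"] by (simp add: card_R) (simp add: R_def)
    then have "(g (coset x) + 1) * m \<le> p ^ (n - 1) * m" by (intro mult_right_mono) auto
    then show ?thesis using m[OF idx(1), of x] by (simp add: c_def)
  qed
  have c_eq: "x - y \<in> {0, 1, - 1}" if "c x = c y" for x y
  proof -
    have "c z div m = g (coset z)" "c z mod m = idx z div 2" for z
      using m[OF idx(1), of z] by (simp_all add: c_def)
    then have "g (coset x) = g (coset y)" and i: "idx x div 2 = idx y div 2" using that by metis+
    then have "coset x = coset y"
      using g by (auto simp: bij_betw_def R_def dest: inj_onD)
    then have "x - y = (x - rep (coset x)) - (y - rep (coset y))" by simp
    then have d: "x - y = of_nat (idx x) - of_nat (idx y)" unfolding idx(2) .
    consider "idx x = idx y" | "idx x = idx y + 1" | "idx y = idx x + 1" using i by linarith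
    then show ?thesis unfolding d by cases simp_all
  qed
  show ?thesis
    unfolding m_def[symmetric] by (intro exI[of _ c] conjI allI impI c_less c_eq)
qed

text \<open>For a difference (x, y) of quadrance 1, the two-square identity gives (a x + b y)^2 + (a
  y - b x)^2 = N. Equal colours force (a y - b x)^2 to be 0 or \<open>\<delta>\<^sup>2\<close>, so N
  or N - \<open>\<delta>\<^sup>2\<close> would be a square. Dividing the form by
  \<open>\<delta>\<close> adapts it to the unit step of the coset colouring.\<close>

lemma exists_unit_quadrance_colouring:
  assumes card: "CARD('a :: finite_field) = p ^ n" and p: "prime p" "odd p" and gt3: "3 < CARD('a)"
  shows "\<exists>c :: 'a \<times> 'a \<Rightarrow> nat. (\<forall>z. c z < p ^ (n - 1) * ((p + 1) div 2))
    \<and> (\<forall>z w. (fst w - fst z)\<^sup>2 + (snd w - snd z)\<^sup>2 = 1 \<longrightarrow> c z \<noteq> c w)"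
proof -
  have odd: "odd CARD('a)" using card p by simp
  have n: "0 < n" using card gt3 by (cases n) auto
  obtain N :: 'a where N: "\<And>x. x\<^sup>2 \<noteq> N" using exists_nonsquare[OF odd] by blast
  obtain a b where ab: "a\<^sup>2 + b\<^sup>2 = N" using exists_sum_two_squares[OF odd] by blast
  obtain \<delta> where \<delta>: "\<delta> \<noteq> 0" "\<And>x. x\<^sup>2 \<noteq> N - \<delta>\<^sup>2" using exists_nonsquare_diff[OF odd gt3 N] by blast
  obtain c :: "'a \<Rightarrow> nat" where c: "\<And>x. c x < p ^ (n - 1) * ((p + 1) div 2)"
    "\<And>x y. c x = c y \<Longrightarrow> x - y \<in> {0, 1, - 1}"
    using exists_coset_colouring[OF card p n] by blast
  define l where "l z = (a * snd z - b * fst z) / \<delta>" for z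
  have "c (l z) \<noteq> c (l w)" if unit: "(fst w - fst z)\<^sup>2 + (snd w - snd z)\<^sup>2 = 1" for z w
  proof
    assume "c (l z) = c (l w)"
    then have "l w - l z \<in> {0, 1, - 1}" using c(2)[of "l w" "l z"] by simp
    define x y where "x = fst w - fst z" and "y = snd w - snd z"
    have "\<delta> * (l w - l z) = a * y - b * x"
    proof -
      have "\<delta> * l u = a * snd u - b * fst u" for u using \<delta>(1) by (simp add: l_def)
      then show ?thesis by (simp only: right_diff_distrib x_def y_def) (simp add: algebra_simps)
    qed
    then have "(a * y - b * x)\<^sup>2 = \<delta>\<^sup>2 * (l w - l z)\<^sup>2" by (simp add: power_mult_distrib flip: \<open>\<delta> * (l w - l z) = _\<close>)
    then have "(a * y - b * x)\<^sup>2 \<in> {0, \<delta>\<^sup>2}" using \<open>l w - l z \<in> {0, 1, - 1}\<close> by auto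
    moreover have "(a * x + b * y)\<^sup>2 + (a * y - b * x)\<^sup>2 = (a\<^sup>2 + b\<^sup>2) * (x\<^sup>2 + y\<^sup>2)"
      by (simp add: algebra_simps power2_eq_square)
    then have "(a * x + b * y)\<^sup>2 = N - (a * y - b * x)\<^sup>2"
      using unit ab by (simp add: x_def y_def eq_diff_eq)
    ultimately show False using N[of "a * x + b * y"] \<delta>(2)[of "a * x + b * y"] by auto
  qed
  then show ?thesis using c(1) by (intro exI[of _ "\<lambda>z. c (l z)"]) blast
qed

section \<open>The lower bound for finite field types\<close>

lemma unit_quadrance_colouring_lower_bound:
  fixes c :: "'a :: finite_field \<times> 'a \<Rightarrow> nat"
  assumes card: "CARD('a) = p ^ n" and p: "prime p" "odd p"
    and c: "\<And>z. c z < k" "\<And>z w. (fst w - fst z)\<^sup>2 + (snd w - snd z)\<^sup>2 = 1 \<Longrightarrow> c z \<noteq> c w"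
  shows "sqrt CARD('a) / 2 \<le> k"
proof -
  define q where "q = CARD('a)"
  obtain \<chi> :: "'a \<Rightarrow> complex" where \<chi>: "add_character UNIV \<chi>"
    "\<And>a. a \<noteq> 0 \<Longrightarrow> norm (kloosterman UNIV \<chi> a) \<le> 2 * sqrt q"
    using exists_character_kloosterman_bound[OF card p] unfolding q_def by blast
  interpret kloosterman_character \<chi> q
    by unfold_locales (use \<chi> card p in \<open>auto simp: q_def\<close>)
  have q1: "1 \<le> real q" using q_pos by simp
  have class_le: "real (card {z. c z = i}) * (real q - 1 + 2 * sqrt q) \<le> 2 * sqrt q * (real q)\<^sup>2" for i
    by (rule card_independent_le) (use c(2) in fastforce)
  have "(real q)\<^sup>2 = real (card (UNIV :: ('a \<times> 'a) set))"
    by (simp add: q_def power2_eq_square card_cartesian_product flip: UNIV_Times_UNIV)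
  also have "card (UNIV :: ('a \<times> 'a) set) = (\<Sum>i<k. card {z. c z = i})"
  proof -
    have "range c \<subseteq> {..<k}" using c(1) by blast
    then show ?thesis
      using sum.group[of "UNIV :: ('a \<times> 'a) set" "{..<k}" c "\<lambda>_. 1 :: nat"] by simp
  qed
  finally have "(real q)\<^sup>2 * (real q - 1 + 2 * sqrt q) = (\<Sum>i<k. real (card {z. c z = i}) * (real q - 1 + 2 * sqrt q))"
    by (simp add: sum_distrib_right)
  also have "\<dots> \<le> (\<Sum>i<k. 2 * sqrt q * (real q)\<^sup>2)" by (rule sum_mono) (rule class_le)
  finally have "(real q)\<^sup>2 * (real q - 1 + 2 * sqrt q) \<le> (real q)\<^sup>2 * (2 * sqrt q * k)"
    by (simp add: mult_ac)
  then have "real q - 1 + 2 * sqrt q \<le> 2 * sqrt q * k"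
    using q1 by simp
  \<comment> \<open>Since 2 sqrt q exceeds 1, the left side is at least q; this removes every error
    term from the lower bound.\<close>
  moreover have "1 \<le> sqrt q" using q1 by simp
  ultimately have "real q \<le> 2 * sqrt q * k" by linarith
  then have "sqrt q * sqrt q \<le> sqrt q * (2 * k)" by (simp add: mult_ac)
  then have "sqrt q \<le> 2 * k" by (rule mult_left_le_imp_le) (use q1 in simp)
  then show ?thesis by (simp add: q_def)
qed

section \<open>Passage to fields given by a carrier set\<close>

text \<open>Both bounds are packed into one property of the ring, with \<open>p\<close> and
  \<open>n\<close> quantified inside. It is invariant under isomorphism, and its failure singles out
  a ring.\<close>

definition quadrance_bounds :: "('a, 'b) ring_scheme \<Rightarrow> bool" where
  "quadrance_bounds F \<longleftrightarrow> (\<forall>p n. prime p \<and> odd p \<and> card (carrier F) = p ^ n \<and> 3 < p ^ n \<longrightarrow>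
     colourable (carrier F \<times> carrier F) (unit_quadrance_adj F) (p ^ (n - 1) * ((p + 1) div 2)) \<and>
     (\<forall>k. colourable (carrier F \<times> carrier F) (unit_quadrance_adj F) k \<longrightarrow> sqrt (p ^ n) / 2 \<le> k))"

section \<open>Transport along ring isomorphisms\<close>

lemma colourable_ring_iso:
  assumes R: "ring R" and S: "ring S" and h: "h \<in> ring_iso R S"
    and col: "colourable (carrier S \<times> carrier S) (unit_quadrance_adj S) k"
  shows "colourable (carrier R \<times> carrier R) (unit_quadrance_adj R) k"
proof -
  interpret ring_hom_ring R S h
    by (rule ring_hom_ringI2[OF R S]) (use h in \<open>simp add: ring_iso_def\<close>)
  let ?V = "carrier S \<times> carrier S"
  from col obtain c where c: "\<forall>v\<in>?V. c v < k"
    "\<forall>u\<in>?V. \<forall>v\<in>?V. unit_quadrance_adj S u v \<longrightarrow> c u \<noteq> c v"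
    unfolding colourable_def by (elim exE conjE)
  have adj: "unit_quadrance_adj S (map_prod h h u) (map_prod h h v)"
    if "u \<in> carrier R \<times> carrier R" "v \<in> carrier R \<times> carrier R" "unit_quadrance_adj R u v" for u v
  proof -
    have mem: "fst u \<in> carrier R" "snd u \<in> carrier R" "fst v \<in> carrier R" "snd v \<in> carrier R"
      using that(1,2) by (auto simp: mem_Times_iff)
    have "h (x \<ominus>\<^bsub>R\<^esub> y) = h x \<ominus>\<^bsub>S\<^esub> h y" if "x \<in> carrier R" "y \<in> carrier R" for x y
      using that by (simp add: a_minus_def)
    then have "quadrance S (map_prod h h u) (map_prod h h v) = h (quadrance R u v)"
      unfolding quadrance_def using mem by (simp add: hom_nat_pow)
    then show ?thesis using that(3) unfolding unit_quadrance_adj_def by simp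
  qed
  have mem: "map_prod h h v \<in> carrier S \<times> carrier S" if "v \<in> carrier R \<times> carrier R" for v
    using that by auto
  show ?thesis
    unfolding colourable_def
  proof (intro exI[of _ "\<lambda>v. c (map_prod h h v)"] conjI ballI impI)
    show "c (map_prod h h v) < k" if "v \<in> carrier R \<times> carrier R" for v
      by (rule c(1)[rule_format, OF mem[OF that]])
    show "c (map_prod h h u) \<noteq> c (map_prod h h v)"
      if "u \<in> carrier R \<times> carrier R" "v \<in> carrier R \<times> carrier R" "unit_quadrance_adj R u v" for u v
      by (rule c(2)[rule_format, OF mem[OF that(1)] mem[OF that(2)] adj[OF that]])
  qed
qed

lemma quadrance_bounds_ring_iso:
  assumes R: "ring R" and S: "ring S" and h: "h \<in> ring_iso R S" and bounds: "quadrance_bounds S"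
  shows "quadrance_bounds R"
proof -
  have "inv_into (carrier R) h \<in> ring_iso S R" by (rule ring_iso_set_sym[OF R h])
  then have "colourable (carrier R \<times> carrier R) (unit_quadrance_adj R) k
      \<longleftrightarrow> colourable (carrier S \<times> carrier S) (unit_quadrance_adj S) k" for k
    using colourable_ring_iso[OF R S h] colourable_ring_iso[OF S R] by blast
  moreover have "card (carrier R) = card (carrier S)"
    using h bij_betw_same_card unfolding ring_iso_def by blast
  ultimately show ?thesis using bounds unfolding quadrance_bounds_def by (simp only:)
qed

lemma quadrance_ring_of_type_algebra:
  "quadrance (ring_of_type_algebra :: 'a :: field ring) A B = (fst B - fst A)\<^sup>2 + (snd B - snd A)\<^sup>2"
proof -
  interpret R: ring "ring_of_type_algebra :: 'a ring" by (rule ring_from_type_algebra)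
  have "\<ominus>\<^bsub>ring_of_type_algebra\<^esub> x = - x" for x :: 'a
    by (rule R.minus_equality) (simp_all add: ring_of_type_algebra_def)
  then have "x \<ominus>\<^bsub>ring_of_type_algebra\<^esub> y = x - y" for x y :: 'a
    unfolding a_minus_def by (simp add: ring_of_type_algebra_def)
  moreover have "x [^]\<^bsub>ring_of_type_algebra\<^esub> (2 :: nat) = x\<^sup>2" for x :: 'a
    using R.nat_pow_Suc[of x 1] R.nat_pow_eone[of x]
    by (simp add: numeral_2_eq_2 power2_eq_square ring_of_type_algebra_def)
  ultimately show ?thesis
    unfolding quadrance_def by (simp add: ring_of_type_algebra_def)
qed

lemma quadrance_bounds_type: "quadrance_bounds (ring_of_type_algebra :: 'a :: finite_field ring)"
proof -
  let ?F = "ring_of_type_algebra :: 'a ring"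
  have carrier: "carrier ?F = UNIV" by (simp add: ring_of_type_algebra_def)
  have adj: "unit_quadrance_adj ?F u v \<longleftrightarrow> (fst v - fst u)\<^sup>2 + (snd v - snd u)\<^sup>2 = 1" for u v
    unfolding unit_quadrance_adj_def quadrance_ring_of_type_algebra
    by (simp add: ring_of_type_algebra_def)
  show ?thesis
    unfolding quadrance_bounds_def colourable_def carrier adj UNIV_Times_UNIV
  proof (intro allI impI conjI, goal_cases)
    case (1 p n)
    then show ?case using exists_unit_quadrance_colouring[where 'a = 'a, of p n] by auto
  next
    case (2 p n k)
    then obtain c :: "'a \<times> 'a \<Rightarrow> nat" where "\<And>v. c v < k"
      "\<And>u v. (fst v - fst u)\<^sup>2 + (snd v - snd u)\<^sup>2 = 1 \<Longrightarrow> c u \<noteq> c v" by blast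
    then show ?case
      using unit_quadrance_colouring_lower_bound[of p n c k] 2 by simp
  qed
qed

text \<open>The field of the theorem is a record with a carrier set, whereas the algebraic closure is
  available for types only, and a type cannot depend on the given field. The type below is
  therefore built from a counterexample to the bounds, if there is one.\<close>

definition extremal_field :: "nat ring" where
  "extremal_field = (SOME F. field F \<and> finite (carrier F) \<and>
     ((\<exists>F' :: nat ring. field F' \<and> finite (carrier F') \<and> \<not> quadrance_bounds F') \<longrightarrow> \<not> quadrance_bounds F))"

text \<open>Copying finite fields onto subsets of \<open>nat\<close> puts them all into one fixed
  record type, so that a single constant can be chosen among them.\<close>

lemma exists_nat_ring_iso:
  assumes "field F" "finite (carrier F)"
  shows "\<exists>(F' :: nat ring) h. field F' \<and> finite (carrier F') \<and> h \<in> ring_iso F F'"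
proof -
  interpret field F by (rule assms)
  obtain f :: "_ \<Rightarrow> nat" where f: "inj_on f (carrier F)"
    using finite_imp_inj_to_nat_seg[OF assms(2)] by auto
  show ?thesis
    using inj_imp_image_ring_is_field[OF f] inj_imp_image_ring_iso[OF f] assms(2)
    by (intro exI[of _ "image_ring f F"] exI[of _ f]) (simp add: image_ring_carrier)
qed

lemma extremal_field:
  shows "field extremal_field" "finite (carrier extremal_field)"
    and "\<And>F :: nat ring. quadrance_bounds extremal_field \<Longrightarrow> field F \<Longrightarrow> finite (carrier F) \<Longrightarrow> quadrance_bounds F"
proof -
  let ?P = "\<lambda>F :: nat ring. field F \<and> finite (carrier F) \<and>
     ((\<exists>F' :: nat ring. field F' \<and> finite (carrier F') \<and> \<not> quadrance_bounds F') \<longrightarrow> \<not> quadrance_bounds F)"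
  \<comment> \<open>The field \<open>gf2\<close> witnesses that some finite field exists, which
    makes the choice sound when there is no counterexample.\<close>
  have "field (ring_of_type_algebra :: gf2 ring)" by (rule field_from_type_algebra)
  then have "\<exists>F :: nat ring. field F \<and> finite (carrier F)"
    using exists_nat_ring_iso[of "ring_of_type_algebra :: gf2 ring"] by auto
  then have "\<exists>F. ?P F" by blast
  then have "?P extremal_field" unfolding extremal_field_def by (rule someI_ex)
  then show "field extremal_field" "finite (carrier extremal_field)"
    "\<And>F :: nat ring. quadrance_bounds extremal_field \<Longrightarrow> field F \<Longrightarrow> finite (carrier F) \<Longrightarrow> quadrance_bounds F"
    by blast+
qed

section \<open>A field type carried by the chosen field\<close>

typedef extremal = "carrier extremal_field"
  using field.is_ring[OF extremal_field(1)] ring.ring_simprules(2) by blast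

setup_lifting type_definition_extremal

interpretation extremal_field: cring extremal_field
  by (rule fieldE(1)[OF extremal_field(1)])

instantiation extremal :: field
begin

lift_definition zero_extremal :: extremal is "\<zero>\<^bsub>extremal_field\<^esub>" by simp
lift_definition one_extremal :: extremal is "\<one>\<^bsub>extremal_field\<^esub>" by simp
lift_definition plus_extremal :: "extremal \<Rightarrow> extremal \<Rightarrow> extremal" is "\<lambda>x y. x \<oplus>\<^bsub>extremal_field\<^esub> y" by simp
lift_definition times_extremal :: "extremal \<Rightarrow> extremal \<Rightarrow> extremal" is "\<lambda>x y. x \<otimes>\<^bsub>extremal_field\<^esub> y" by simp
lift_definition uminus_extremal :: "extremal \<Rightarrow> extremal" is "\<lambda>x. \<ominus>\<^bsub>extremal_field\<^esub> x" by simp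
lift_definition minus_extremal :: "extremal \<Rightarrow> extremal \<Rightarrow> extremal" is "\<lambda>x y. x \<ominus>\<^bsub>extremal_field\<^esub> y" by simp
lift_definition inverse_extremal :: "extremal \<Rightarrow> extremal"
  is "\<lambda>x. if x = \<zero>\<^bsub>extremal_field\<^esub> then \<zero>\<^bsub>extremal_field\<^esub> else inv\<^bsub>extremal_field\<^esub> x"
  by (auto simp: field.field_Units[OF extremal_field(1)])
definition divide_extremal :: "extremal \<Rightarrow> extremal \<Rightarrow> extremal" where
  "divide_extremal x y = x * inverse y"

instance
proof
  fix a b c :: extremal
  show "a * b * c = a * (b * c)" by transfer (rule extremal_field.m_assoc)
  show "a * b = b * a" by transfer (rule extremal_field.m_comm)
  show "1 * a = a" by transfer (rule extremal_field.l_one)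
  show "a + b + c = a + (b + c)" by transfer (rule extremal_field.a_assoc)
  show "a + b = b + a" by transfer (rule extremal_field.a_comm)
  show "0 + a = a" by transfer (rule extremal_field.l_zero)
  show "- a + a = 0" by transfer (rule extremal_field.l_neg)
  show "a - b = a + - b" by transfer (rule extremal_field.minus_eq)
  show "(a + b) * c = a * c + b * c" by transfer (rule extremal_field.l_distr)
  show "(0 :: extremal) \<noteq> 1" by transfer (rule not_sym[OF fieldE(2)[OF extremal_field(1)]])
  show "a \<noteq> 0 \<Longrightarrow> inverse a * a = 1"
    by transfer (simp add: field.field_Units[OF extremal_field(1)])
  show "a div b = a * inverse b" by (rule divide_extremal_def)
  show "inverse (0 :: extremal) = 0" by transfer simp
qed

end

instance extremal :: finite_field
proof
  have "(UNIV :: extremal set) = Abs_extremal ` carrier extremal_field"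
    by (metis type_definition.Abs_image type_definition_extremal)
  then show "finite (UNIV :: extremal set)" using extremal_field(2) by (metis finite_imageI)
qed

lemma Rep_extremal_ring_iso: "Rep_extremal \<in> ring_iso ring_of_type_algebra extremal_field"
proof (rule ring_iso_memI)
  show "bij_betw Rep_extremal (carrier ring_of_type_algebra) (carrier extremal_field)"
    unfolding bij_betw_def using Rep_extremal_inject type_definition.Rep_range[OF type_definition_extremal]
    by (auto simp: ring_of_type_algebra_def inj_on_def)
qed (auto simp: ring_of_type_algebra_def Rep_extremal times_extremal.rep_eq plus_extremal.rep_eq one_extremal.rep_eq)

lemma quadrance_bounds_finite_field:
  assumes "field (F :: 'a ring)" "finite (carrier F)"
  shows "quadrance_bounds F"
proof -
  have "inv_into (carrier ring_of_type_algebra) Rep_extremal \<in> ring_iso extremal_field ring_of_type_algebra"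
    by (rule ring_iso_set_sym[OF ring_from_type_algebra Rep_extremal_ring_iso])
  then have extremal: "quadrance_bounds extremal_field"
    by (rule quadrance_bounds_ring_iso[OF extremal_field.ring_axioms ring_from_type_algebra _ quadrance_bounds_type])
  obtain F' :: "nat ring" and h where F': "field F'" "finite (carrier F')" "h \<in> ring_iso F F'"
    using exists_nat_ring_iso[OF assms] by (elim exE conjE)
  have "quadrance_bounds F'" by (rule extremal_field(3)[OF extremal F'(1,2)])
  then show ?thesis
    by (rule quadrance_bounds_ring_iso[OF field.is_ring[OF assms(1)] field.is_ring[OF F'(1)] F'(3)])
qed

theorem theorem1:
  "\<exists>\<epsilon> \<delta> :: nat \<Rightarrow> real. \<epsilon> \<longlonglongrightarrow> 0 \<and> \<delta> \<longlonglongrightarrow> 0 \<and>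
     (\<forall>p n q :: nat. prime p \<and> odd p \<and> q = p ^ n \<and> q > 3 \<longrightarrow>
        (\<forall>F :: 'a ring. field F \<and> card (carrier F) = q \<longrightarrow>
           sqrt (real q) * (1/2 + \<epsilon> q) \<le> real (plane_chromatic_number F) \<and>
           real (plane_chromatic_number F) \<le> (real p ^ n + real p ^ (n - 1)) / 2) \<and>
        (real p ^ n + real p ^ (n - 1)) / 2 = real q * (1/2 + \<delta> p))"
proof (intro exI conjI allI impI)
  \<comment> \<open>The lower bound is sqrt q / 2 for every q > 3, so the first error term is taken
    to be identically 0. The second is 1 / (2 p), because p^(n - 1) = q / p.\<close>
  show "(\<lambda>_ :: nat. 0 :: real) \<longlonglongrightarrow> 0" by simp
  have "(\<lambda>p. 1 / 2 * inverse (real p)) \<longlonglongrightarrow> 1 / 2 * 0"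
    by (intro tendsto_mult tendsto_const lim_inverse_n)
  then show "(\<lambda>p. 1 / 2 * inverse (real p)) \<longlonglongrightarrow> 0" by simp
next
  fix p n q :: nat
  assume asm: "prime p \<and> odd p \<and> q = p ^ n \<and> q > 3"
  then have n: "n = Suc (n - 1)" by (cases n) auto
  have p: "0 < real p" using asm prime_gt_0_nat by auto
  have pn: "real p ^ n = real p * real p ^ (n - 1)" using n by (metis power_Suc)
  show "(real p ^ n + real p ^ (n - 1)) / 2 = real q * (1/2 + 1 / 2 * inverse (real p))"
    using asm p by (simp add: pn field_simps)
  fix F :: "'a ring"
  assume F: "field F \<and> card (carrier F) = q"
  define V where "V = carrier F \<times> carrier F"
  have "finite (carrier F)" using F asm by (metis card.infinite not_less_zero)
  then have bounds: "colourable V (unit_quadrance_adj F) (p ^ (n - 1) * ((p + 1) div 2))"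
    "\<And>k. colourable V (unit_quadrance_adj F) k \<Longrightarrow> sqrt q / 2 \<le> k"
    using quadrance_bounds_finite_field[of F] F asm unfolding quadrance_bounds_def V_def by auto
  have chi: "plane_chromatic_number F = (LEAST k. colourable V (unit_quadrance_adj F) k)"
    by (simp add: plane_chromatic_number_def chromatic_number_def V_def)
  have "colourable V (unit_quadrance_adj F) (plane_chromatic_number F)"
    unfolding chi by (rule LeastI) (rule bounds(1))
  then show "sqrt (real q) * (1/2 + 0) \<le> real (plane_chromatic_number F)"
    using bounds(2) by simp
  have "plane_chromatic_number F \<le> p ^ (n - 1) * ((p + 1) div 2)"
    unfolding chi by (rule Least_le) (rule bounds(1))
  then have "real (plane_chromatic_number F) \<le> real (p ^ (n - 1) * ((p + 1) div 2))"
    by (simp only: of_nat_le_iff)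
  also have "\<dots> = real p ^ (n - 1) * ((real p + 1) / 2)"
  proof -
    have "odd p" using asm by simp
    then have "2 * ((p + 1) div 2) = p + 1" by presburger
    then have "real (2 * ((p + 1) div 2)) = real (p + 1)" by (simp only:)
    then have "real ((p + 1) div 2) = (real p + 1) / 2" by simp
    then show ?thesis by (simp only: of_nat_mult of_nat_power)
  qed
  also have "\<dots> = (real p ^ n + real p ^ (n - 1)) / 2"
    by (simp add: pn algebra_simps)
  finally show "real (plane_chromatic_number F) \<le> (real p ^ n + real p ^ (n - 1)) / 2" .
qed

end
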